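(* (ZFC) $SOA$ is not definitionally equivalent with $ZFC_{count}$.
   Context: The background theory in which this is proved is $ZFC$, with no further assumptions. $ZFC_{count}$ is the theory in the language $\mathcal{L}_\in$ consisting of $ZFC^-$, i.e. $ZFC$ without the powerset axiom and formulated with the Collection schema rather than Replacement (Extensionality, Foundation, Pairing, Union, Infinity, Separation schema, Collection schema, Choice), together with the axiom that every set is countable. $SOA$ is second order arithmetic with full comprehension and definable choice: its objects are numbers and sets of numbers; its axioms are the usual basic axioms for $0,1,+,\cdot,<$ on numbers, extensionality for sets, induction, comprehension for all formulas of the language (with parameters), and for every formula $\varphi(n,Y)$ (with parameters) the choice axiom: if for all $n$ there is $Y$ with $\varphi(n,Y)$, then there is $Z$ such that for all $n$, $\varphi(n,(Z)_n)$, where $(Z)_n=\{i : (i,n)\in Z\}$. It is treated as a one-sorted theory whose single domain comprises the numbers and the sets, with predicates distinguishing the two. A (parameter-free) translation $t:\mathcal{L}_S\to\mathcal{L}_T$ giving an interpretation of $S$ in $T$ induces a function $t:mod(T)\to mod(S)$ sending a model $\mathcal{A}$ of $T$ to the model $t(\mathcal{A})$ of $S$ it defines in $\mathcal{A}$. The interpretation is direct if it is one-dimensional, does not restrict the domain, and translates identity to identity. Theories $T$ and $S$ are definitionally equivalent if there are interpretations $t:mod(T)\to mod(S)$ and $s:mod(S)\to mod(T)$ such that $\mathcal{A}=s\circ t(\mathcal{A})$ for all models $\mathcal{A}$ of $T$ and $\mathcal{B}=t\circ s(\mathcal{B})$ for all models $\mathcal{B}$ of $S$; interpretations witnessing definitional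 equivalence are direct. *)

theory Defs
  imports Main
begin

section \<open>First-order logic over relational languages\<close>

datatype 'r fm =
    Eq nat nat  (infix \<open>\<^bold>=\<close> 60)
  | Rel 'r "nat list"
  | Neg "'r fm"  (\<open>\<^bold>\<not> _\<close> [50] 50)
  | Conj "'r fm" "'r fm"  (infixr \<open>\<^bold>\<and>\<close> 40)
  | FAll nat "'r fm"  (\<open>(3\<^bold>\<forall>_./ _)\<close> [0, 10] 10)

abbreviation Disj :: "'r fm \<Rightarrow> 'r fm \<Rightarrow> 'r fm"  (infixr \<open>\<^bold>\<or>\<close> 35) where
  "\<phi> \<^bold>\<or> \<psi> \<equiv> \<^bold>\<not> (\<^bold>\<not> \<phi> \<^bold>\<and> \<^bold>\<not> \<psi>)"

abbreviation Imp :: "'r fm \<Rightarrow> 'r fm \<Rightarrow> 'r fm"  (infixr \<open>\<^bold>\<longrightarrow>\<close> 30) where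
  "\<phi> \<^bold>\<longrightarrow> \<psi> \<equiv> \<^bold>\<not> (\<phi> \<^bold>\<and> \<^bold>\<not> \<psi>)"

abbreviation Iff :: "'r fm \<Rightarrow> 'r fm \<Rightarrow> 'r fm"  (infixr \<open>\<^bold>\<longleftrightarrow>\<close> 25) where
  "\<phi> \<^bold>\<longleftrightarrow> \<psi> \<equiv> (\<phi> \<^bold>\<longrightarrow> \<psi>) \<^bold>\<and> (\<psi> \<^bold>\<longrightarrow> \<phi>)"

abbreviation FEx :: "nat \<Rightarrow> 'r fm \<Rightarrow> 'r fm"  (\<open>(3\<^bold>\<exists>_./ _)\<close> [0, 10] 10) where
  "\<^bold>\<exists>x. \<phi> \<equiv> \<^bold>\<not> (\<^bold>\<forall>x. \<^bold>\<not> \<phi>)"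

primrec fv :: "'r fm \<Rightarrow> nat set" where
  "fv (x \<^bold>= y) = {x, y}"
| "fv (Rel r xs) = set xs"
| "fv (\<^bold>\<not> \<phi>) = fv \<phi>"
| "fv (\<phi> \<^bold>\<and> \<psi>) = fv \<phi> \<union> fv \<psi>"
| "fv (\<^bold>\<forall>x. \<phi>) = fv \<phi> - {x}"

primrec wf_fm :: "('r \<Rightarrow> nat) \<Rightarrow> 'r fm \<Rightarrow> bool" where
  "wf_fm ar (x \<^bold>= y) \<longleftrightarrow> True"
| "wf_fm ar (Rel r xs) \<longleftrightarrow> length xs = ar r"
| "wf_fm ar (\<^bold>\<not> \<phi>) \<longleftrightarrow> wf_fm ar \<phi>"
| "wf_fm ar (\<phi> \<^bold>\<and> \<psi>) \<longleftrightarrow> wf_fm ar \<phi> \<and> wf_fm ar \<psi>"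
| "wf_fm ar (\<^bold>\<forall>x. \<phi>) \<longleftrightarrow> wf_fm ar \<phi>"

record ('r, 'a) struct =
  Dom :: "'a set"
  Rels :: "'r \<Rightarrow> 'a list set"

primrec sat :: "('r, 'a) struct \<Rightarrow> (nat \<Rightarrow> 'a) \<Rightarrow> 'r fm \<Rightarrow> bool" where
  "sat A e (x \<^bold>= y) \<longleftrightarrow> e x = e y"
| "sat A e (Rel r xs) \<longleftrightarrow> map e xs \<in> Rels A r"
| "sat A e (\<^bold>\<not> \<phi>) \<longleftrightarrow> \<not> sat A e \<phi>"
| "sat A e (\<phi> \<^bold>\<and> \<psi>) \<longleftrightarrow> sat A e \<phi> \<and> sat A e \<psi>"
| "sat A e (\<^bold>\<forall>x. \<phi>) \<longleftrightarrow> (\<forall>a \<in> Dom A. sat A (e(x := a)) \<phi>)"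

record 'r fo_theory =
  arity :: "'r \<Rightarrow> nat"
  Axioms :: "'r fm set"

definition tuples :: "'a set \<Rightarrow> nat \<Rightarrow> 'a list set" where
  "tuples D n = {xs. length xs = n \<and> set xs \<subseteq> D}"

text \<open>Interpreting relation symbols by sets of tuples over the domain, with nothing outside it,
  makes equality of structures the literal equality of records. Axioms may have free variables
  and stand for their universal closures.\<close>

definition models :: "'r fo_theory \<Rightarrow> ('r, 'a) struct set" where
  "models T = {A. Dom A \<noteq> {} \<and> (\<forall>r. Rels A r \<subseteq> tuples (Dom A) (arity T r)) \<and>
     (\<forall>\<phi> \<in> Axioms T. \<forall>e. range e \<subseteq> Dom A \<longrightarrow> sat A e \<phi>)}"


section \<open>Direct interpretations and definitional equivalence\<close>

text \<open>A parameter-free direct translation of the language of \<open>S\<close> into that of \<open>T\<close> leaves equality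
  and the range of the quantifiers alone, so it is given by a formula for each relation symbol;
  variable \<open>i\<close> of this formula is the \<open>i\<close>-th argument of the symbol, counting from 0. Interpretations
  witnessing definitional equivalence are direct, so no other translations are needed.\<close>

definition direct_translation ::
  "'s fo_theory \<Rightarrow> 't fo_theory \<Rightarrow> ('s \<Rightarrow> 't fm) \<Rightarrow> bool" where
  "direct_translation S T t \<longleftrightarrow>
     (\<forall>r. wf_fm (arity T) (t r) \<and> fv (t r) \<subseteq> {..<arity S r})"

definition induced :: "'s fo_theory \<Rightarrow> ('s \<Rightarrow> 't fm) \<Rightarrow> ('t, 'a) struct \<Rightarrow> ('s, 'a) struct" where
  "induced S t A = \<lparr>Dom = Dom A,
     Rels = (\<lambda>r. {xs \<in> tuples (Dom A) (arity S r). sat A ((!) xs) (t r)})\<rparr>"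

text \<open>A formula cannot quantify over types, so the type \<open>'a\<close> from which the domains
  of models are taken is a parameter. By the downward Loewenheim-Skolem theorem the choice
  of \<open>'a\<close> is immaterial for countable languages, as long as \<open>'a\<close> is infinite.\<close>

definition direct_interpretation ::
  "'a itself \<Rightarrow> 's fo_theory \<Rightarrow> 't fo_theory \<Rightarrow> ('s \<Rightarrow> 't fm) \<Rightarrow> bool" where
  "direct_interpretation _ S T t \<longleftrightarrow> direct_translation S T t \<and>
     (\<forall>A :: ('t, 'a) struct \<in> models T. induced S t A \<in> models S)"

definition definitionally_equivalent ::
  "'a itself \<Rightarrow> 't fo_theory \<Rightarrow> 's fo_theory \<Rightarrow> bool" where
  "definitionally_equivalent U T S \<longleftrightarrow>
     (\<exists>t s. direct_interpretation U S T t \<and> direct_interpretation U T S s \<and>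
       (\<forall>A :: ('t, 'a) struct \<in> models T. A = induced T s (induced S t A)) \<and>
       (\<forall>B :: ('s, 'a) struct \<in> models S. B = induced S t (induced T s B)))"


section \<open>Set theory with all sets countable\<close>

text \<open>A variable distinct from all the listed ones.\<close>

definition fresh :: "nat list \<Rightarrow> nat" where
  "fresh xs = Suc (sum_list xs)"

datatype mem_sym = Mem

abbreviation mem :: "nat \<Rightarrow> nat \<Rightarrow> mem_sym fm"  (infix \<open>\<^bold>\<in>\<close> 60) where
  "x \<^bold>\<in> y \<equiv> Rel Mem [x, y]"

definition is_emptyset :: "nat \<Rightarrow> mem_sym fm" where
  "is_emptyset x = (let z = fresh [x] in \<^bold>\<forall>z. \<^bold>\<not> z \<^bold>\<in> x)"

text \<open>\<open>y = x \<union> {x}\<close>\<close>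

definition is_suc :: "nat \<Rightarrow> nat \<Rightarrow> mem_sym fm" where
  "is_suc x y = (let z = fresh [x, y] in \<^bold>\<forall>z. z \<^bold>\<in> y \<^bold>\<longleftrightarrow> z \<^bold>\<in> x \<^bold>\<or> z \<^bold>= x)"

text \<open>\<open>p = {x, y}\<close>\<close>

definition is_upair :: "nat \<Rightarrow> nat \<Rightarrow> nat \<Rightarrow> mem_sym fm" where
  "is_upair x y p = (let z = fresh [x, y, p] in \<^bold>\<forall>z. z \<^bold>\<in> p \<^bold>\<longleftrightarrow> z \<^bold>= x \<^bold>\<or> z \<^bold>= y)"

text \<open>\<open>p = {{x}, {x, y}}\<close>\<close>

definition is_pair :: "nat \<Rightarrow> nat \<Rightarrow> nat \<Rightarrow> mem_sym fm" where
  "is_pair x y p = (let u = fresh [x, y, p]; v = fresh [x, y, p, u] in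
     \<^bold>\<exists>u. \<^bold>\<exists>v. is_upair x x u \<^bold>\<and> is_upair x y v \<^bold>\<and> is_upair u v p)"

definition pair_in :: "nat \<Rightarrow> nat \<Rightarrow> nat \<Rightarrow> mem_sym fm" where
  "pair_in x y f = (let p = fresh [x, y, f] in \<^bold>\<exists>p. is_pair x y p \<^bold>\<and> p \<^bold>\<in> f)"

definition is_inductive :: "nat \<Rightarrow> mem_sym fm" where
  "is_inductive w = (let x = fresh [w]; y = fresh [w, x] in
     (\<^bold>\<exists>x. is_emptyset x \<^bold>\<and> x \<^bold>\<in> w) \<^bold>\<and>
     (\<^bold>\<forall>x. x \<^bold>\<in> w \<^bold>\<longrightarrow> (\<^bold>\<exists>y. is_suc x y \<^bold>\<and> y \<^bold>\<in> w)))"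

definition is_omega :: "nat \<Rightarrow> mem_sym fm" where
  "is_omega w = (let v = fresh [w]; x = fresh [w, v] in
     is_inductive w \<^bold>\<and> (\<^bold>\<forall>v. is_inductive v \<^bold>\<longrightarrow> (\<^bold>\<forall>x. x \<^bold>\<in> w \<^bold>\<longrightarrow> x \<^bold>\<in> v)))"

definition is_injection :: "nat \<Rightarrow> nat \<Rightarrow> nat \<Rightarrow> mem_sym fm" where
  "is_injection f a b =
     (let x = fresh [f, a, b]; y = fresh [f, a, b, x]; z = fresh [f, a, b, x, y] in
       (\<^bold>\<forall>z. z \<^bold>\<in> f \<^bold>\<longrightarrow> (\<^bold>\<exists>x. \<^bold>\<exists>y. x \<^bold>\<in> a \<^bold>\<and> y \<^bold>\<in> b \<^bold>\<and> is_pair x y z)) \<^bold>\<and>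
       (\<^bold>\<forall>x. x \<^bold>\<in> a \<^bold>\<longrightarrow> (\<^bold>\<exists>y. pair_in x y f)) \<^bold>\<and>
       (\<^bold>\<forall>x. \<^bold>\<forall>y. \<^bold>\<forall>z. pair_in x y f \<^bold>\<and> pair_in x z f \<^bold>\<longrightarrow> y \<^bold>= z) \<^bold>\<and>
       (\<^bold>\<forall>x. \<^bold>\<forall>y. \<^bold>\<forall>z. pair_in x z f \<^bold>\<and> pair_in y z f \<^bold>\<longrightarrow> x \<^bold>= y))"

abbreviation mem_arity :: "mem_sym \<Rightarrow> nat" where
  "mem_arity \<equiv> (\<lambda>_. 2)"

text \<open>Free variables of \<open>\<phi>\<close> not mentioned explicitly are the parameters of the schemas.\<close>

inductive_set ZFC_count_axioms :: "mem_sym fm set" where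
  extensionality: "distinct [x, y, z] \<Longrightarrow>
    ((\<^bold>\<forall>z. z \<^bold>\<in> x \<^bold>\<longleftrightarrow> z \<^bold>\<in> y) \<^bold>\<longrightarrow> x \<^bold>= y) \<in> ZFC_count_axioms"
| foundation: "distinct [x, y, z] \<Longrightarrow>
    ((\<^bold>\<exists>y. y \<^bold>\<in> x) \<^bold>\<longrightarrow> (\<^bold>\<exists>y. y \<^bold>\<in> x \<^bold>\<and> \<^bold>\<not> (\<^bold>\<exists>z. z \<^bold>\<in> x \<^bold>\<and> z \<^bold>\<in> y))) \<in> ZFC_count_axioms"
| pairing: "distinct [x, y, p] \<Longrightarrow>
    (\<^bold>\<exists>p. is_upair x y p) \<in> ZFC_count_axioms"
| union: "distinct [x, y, z, u] \<Longrightarrow>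
    (\<^bold>\<exists>u. \<^bold>\<forall>z. z \<^bold>\<in> u \<^bold>\<longleftrightarrow> (\<^bold>\<exists>y. y \<^bold>\<in> x \<^bold>\<and> z \<^bold>\<in> y)) \<in> ZFC_count_axioms"
| infinity:
    "(\<^bold>\<exists>w. is_inductive w) \<in> ZFC_count_axioms"
| separation: "distinct [x, a, b] \<Longrightarrow> wf_fm mem_arity \<phi> \<Longrightarrow> b \<notin> fv \<phi> \<Longrightarrow>
    (\<^bold>\<exists>b. \<^bold>\<forall>x. x \<^bold>\<in> b \<^bold>\<longleftrightarrow> x \<^bold>\<in> a \<^bold>\<and> \<phi>) \<in> ZFC_count_axioms"
| collection: "distinct [x, y, a, b] \<Longrightarrow> wf_fm mem_arity \<phi> \<Longrightarrow> b \<notin> fv \<phi> \<Longrightarrow>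
    ((\<^bold>\<forall>x. x \<^bold>\<in> a \<^bold>\<longrightarrow> (\<^bold>\<exists>y. \<phi>)) \<^bold>\<longrightarrow>
    (\<^bold>\<exists>b. \<^bold>\<forall>x. x \<^bold>\<in> a \<^bold>\<longrightarrow> (\<^bold>\<exists>y. y \<^bold>\<in> b \<^bold>\<and> \<phi>))) \<in> ZFC_count_axioms"
| choice: "distinct [a, c, x, y, z, u] \<Longrightarrow>
    ((\<^bold>\<forall>x. x \<^bold>\<in> a \<^bold>\<longrightarrow> (\<^bold>\<exists>z. z \<^bold>\<in> x)) \<^bold>\<and>
    (\<^bold>\<forall>x. \<^bold>\<forall>y. x \<^bold>\<in> a \<^bold>\<and> y \<^bold>\<in> a \<^bold>\<and> (\<^bold>\<exists>z. z \<^bold>\<in> x \<^bold>\<and> z \<^bold>\<in> y) \<^bold>\<longrightarrow> x \<^bold>= y) \<^bold>\<longrightarrow>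
    (\<^bold>\<exists>c. \<^bold>\<forall>x. x \<^bold>\<in> a \<^bold>\<longrightarrow> (\<^bold>\<exists>u. \<^bold>\<forall>z. z \<^bold>\<in> x \<^bold>\<and> z \<^bold>\<in> c \<^bold>\<longleftrightarrow> z \<^bold>= u))) \<in> ZFC_count_axioms"
| all_countable: "distinct [x, f, w] \<Longrightarrow>
    (\<^bold>\<exists>f. \<^bold>\<exists>w. is_omega w \<^bold>\<and> is_injection f x w) \<in> ZFC_count_axioms"

definition ZFC_count :: "mem_sym fo_theory" where
  "ZFC_count = \<lparr>arity = mem_arity, Axioms = ZFC_count_axioms\<rparr>"


section \<open>Second-order arithmetic\<close>

text \<open>The language is relational: \<open>Zero x\<close> and \<open>One x\<close> say \<open>x = 0\<close> and \<open>x = 1\<close>, and \<open>Add x y z\<close>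
  and \<open>Mul x y z\<close> are the graphs \<open>x + y = z\<close> and \<open>x \<cdot> y = z\<close>. The arithmetic relations hold of
  numbers only, and \<open>Elem\<close> holds between numbers and sets only.\<close>

datatype soa_sym = NumS | SetS | ZeroS | OneS | AddS | MulS | LessS | ElemS

primrec soa_arity :: "soa_sym \<Rightarrow> nat" where
  "soa_arity NumS = 1"
| "soa_arity SetS = 1"
| "soa_arity ZeroS = 1"
| "soa_arity OneS = 1"
| "soa_arity AddS = 3"
| "soa_arity MulS = 3"
| "soa_arity LessS = 2"
| "soa_arity ElemS = 2"

abbreviation "Num x \<equiv> Rel NumS [x]"
abbreviation "Set x \<equiv> Rel SetS [x]"
abbreviation "Zero x \<equiv> Rel ZeroS [x]"
abbreviation "One x \<equiv> Rel OneS [x]"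
abbreviation "Add x y z \<equiv> Rel AddS [x, y, z]"
abbreviation "Mul x y z \<equiv> Rel MulS [x, y, z]"
abbreviation "Less x y \<equiv> Rel LessS [x, y]"
abbreviation "Elem x y \<equiv> Rel ElemS [x, y]"

text \<open>\<open>m = n + 1\<close>\<close>

definition is_plus1 :: "nat \<Rightarrow> nat \<Rightarrow> soa_sym fm" where
  "is_plus1 n m = (let u = fresh [n, m] in \<^bold>\<exists>u. One u \<^bold>\<and> Add n u m)"

text \<open>Numbers are paired by \<open>(i, n) = (i + n)\<^sup>2 + i\<close>.\<close>

definition is_code :: "nat \<Rightarrow> nat \<Rightarrow> nat \<Rightarrow> soa_sym fm" where
  "is_code i n p = (let s = fresh [i, n, p]; q = fresh [i, n, p, s] in
     \<^bold>\<exists>s. \<^bold>\<exists>q. Add i n s \<^bold>\<and> Mul s s q \<^bold>\<and> Add q i p)"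

text \<open>\<open>Y = (Z)\<^sub>n\<close>\<close>

definition is_section :: "nat \<Rightarrow> nat \<Rightarrow> nat \<Rightarrow> soa_sym fm" where
  "is_section Z n Y = (let i = fresh [Z, n, Y]; p = fresh [Z, n, Y, i] in
     Set Y \<^bold>\<and> (\<^bold>\<forall>i. Elem i Y \<^bold>\<longleftrightarrow> (\<^bold>\<exists>p. is_code i n p \<^bold>\<and> Elem p Z)))"

inductive_set SOA_axioms :: "soa_sym fm set" where
  sorts: "((Num x \<^bold>\<or> Set x) \<^bold>\<and> \<^bold>\<not> (Num x \<^bold>\<and> Set x)) \<in> SOA_axioms"
| Zero_sort: "(Zero x \<^bold>\<longrightarrow> Num x) \<in> SOA_axioms"
| One_sort: "(One x \<^bold>\<longrightarrow> Num x) \<in> SOA_axioms"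
| Add_sort: "distinct [x, y, z] \<Longrightarrow> (Add x y z \<^bold>\<longrightarrow> Num x \<^bold>\<and> Num y \<^bold>\<and> Num z) \<in> SOA_axioms"
| Mul_sort: "distinct [x, y, z] \<Longrightarrow> (Mul x y z \<^bold>\<longrightarrow> Num x \<^bold>\<and> Num y \<^bold>\<and> Num z) \<in> SOA_axioms"
| Less_sort: "distinct [x, y] \<Longrightarrow> (Less x y \<^bold>\<longrightarrow> Num x \<^bold>\<and> Num y) \<in> SOA_axioms"
| Elem_sort: "distinct [x, y] \<Longrightarrow> (Elem x y \<^bold>\<longrightarrow> Num x \<^bold>\<and> Set y) \<in> SOA_axioms"
| Zero_fun: "distinct [x, y] \<Longrightarrow> (\<^bold>\<exists>x. \<^bold>\<forall>y. Zero y \<^bold>\<longleftrightarrow> y \<^bold>= x) \<in> SOA_axioms"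
| One_fun: "distinct [x, y] \<Longrightarrow> (\<^bold>\<exists>x. \<^bold>\<forall>y. One y \<^bold>\<longleftrightarrow> y \<^bold>= x) \<in> SOA_axioms"
| Add_fun: "distinct [x, y, z, u] \<Longrightarrow>
    (Num x \<^bold>\<and> Num y \<^bold>\<longrightarrow> (\<^bold>\<exists>z. \<^bold>\<forall>u. Add x y u \<^bold>\<longleftrightarrow> u \<^bold>= z)) \<in> SOA_axioms"
| Mul_fun: "distinct [x, y, z, u] \<Longrightarrow>
    (Num x \<^bold>\<and> Num y \<^bold>\<longrightarrow> (\<^bold>\<exists>z. \<^bold>\<forall>u. Mul x y u \<^bold>\<longleftrightarrow> u \<^bold>= z)) \<in> SOA_axioms"
| plus1_nonzero: "distinct [n, n'] \<Longrightarrow>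
    (is_plus1 n n' \<^bold>\<longrightarrow> \<^bold>\<not> Zero n') \<in> SOA_axioms"
| plus1_inject: "distinct [m, n, k] \<Longrightarrow>
    (is_plus1 m k \<^bold>\<and> is_plus1 n k \<^bold>\<longrightarrow> m \<^bold>= n) \<in> SOA_axioms"
| Add_zero: "distinct [m, z] \<Longrightarrow>
    (Num m \<^bold>\<and> Zero z \<^bold>\<longrightarrow> Add m z m) \<in> SOA_axioms"
| Add_plus1: "distinct [m, n, n', s, s'] \<Longrightarrow>
    (is_plus1 n n' \<^bold>\<and> Add m n s \<^bold>\<and> is_plus1 s s' \<^bold>\<longrightarrow> Add m n' s') \<in> SOA_axioms"
| Mul_zero: "distinct [m, z] \<Longrightarrow>
    (Num m \<^bold>\<and> Zero z \<^bold>\<longrightarrow> Mul m z z) \<in> SOA_axioms"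
| Mul_plus1: "distinct [m, n, n', p, q] \<Longrightarrow>
    (is_plus1 n n' \<^bold>\<and> Mul m n p \<^bold>\<and> Add p m q \<^bold>\<longrightarrow> Mul m n' q) \<in> SOA_axioms"
| Less_zero: "distinct [m, z] \<Longrightarrow>
    (Zero z \<^bold>\<longrightarrow> \<^bold>\<not> Less m z) \<in> SOA_axioms"
| Less_plus1: "distinct [m, n, n'] \<Longrightarrow>
    (Num m \<^bold>\<and> is_plus1 n n' \<^bold>\<longrightarrow> (Less m n' \<^bold>\<longleftrightarrow> Less m n \<^bold>\<or> m \<^bold>= n)) \<in> SOA_axioms"
| extensionality: "distinct [X, Y, n] \<Longrightarrow>
    (Set X \<^bold>\<and> Set Y \<^bold>\<and> (\<^bold>\<forall>n. Elem n X \<^bold>\<longleftrightarrow> Elem n Y) \<^bold>\<longrightarrow> X \<^bold>= Y) \<in> SOA_axioms"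
| induction: "distinct [X, n, n'] \<Longrightarrow>
    (Set X \<^bold>\<and> (\<^bold>\<forall>n. Zero n \<^bold>\<longrightarrow> Elem n X) \<^bold>\<and>
    (\<^bold>\<forall>n. \<^bold>\<forall>n'. Elem n X \<^bold>\<and> is_plus1 n n' \<^bold>\<longrightarrow> Elem n' X) \<^bold>\<longrightarrow>
    (\<^bold>\<forall>n. Num n \<^bold>\<longrightarrow> Elem n X)) \<in> SOA_axioms"
| comprehension: "distinct [X, n] \<Longrightarrow> wf_fm soa_arity \<phi> \<Longrightarrow> X \<notin> fv \<phi> \<Longrightarrow>
    (\<^bold>\<exists>X. Set X \<^bold>\<and> (\<^bold>\<forall>n. Num n \<^bold>\<longrightarrow> (Elem n X \<^bold>\<longleftrightarrow> \<phi>))) \<in> SOA_axioms"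
| choice: "distinct [n, Y, Z] \<Longrightarrow> wf_fm soa_arity \<phi> \<Longrightarrow> Z \<notin> fv \<phi> \<Longrightarrow>
    ((\<^bold>\<forall>n. Num n \<^bold>\<longrightarrow> (\<^bold>\<exists>Y. Set Y \<^bold>\<and> \<phi>)) \<^bold>\<longrightarrow>
    (\<^bold>\<exists>Z. Set Z \<^bold>\<and> (\<^bold>\<forall>n. Num n \<^bold>\<longrightarrow> (\<^bold>\<exists>Y. is_section Z n Y \<^bold>\<and> \<phi>)))) \<in> SOA_axioms"

definition SOA :: "soa_sym fo_theory" where
  "SOA = \<lparr>arity = soa_arity, Axioms = SOA_axioms\<rparr>"

end

theory Submission imports Defs "HOL-Library.Countable_Set"
begin

text \<open>
Suppose the theories were definitionally equivalent. Then on the domain of any model of \<open>SOA\<close> some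
relation, definable without parameters, yields a model of \<open>ZFC_count\<close> from which the arithmetic is
definable in turn. Call two sets of numbers eventually equal if they differ in finitely many
numbers. Each class of this relation is countable, so the set model contains it as an element
(\<open>eventually_equal_class_exists\<close>), and this element is again a point of the common domain: a number
or a set of numbers. The relation is thereby reduced, by a definition without parameters, to
equality of numbers and sets of numbers. Such a reduction of \<open>E\<^sub>0\<close> to equality is refuted by a Cohen
real. Let \<open>c\<close> be one. Its complement is not eventually equal to it, so the two have different
classes. But Cohen forcing is homogeneous: whatever a condition \<open>p\<close> forces of the complement
of \<open>c\<close>, it also forces of the real obtained from \<open>c\<close> by flipping only the finitely many bits
that \<open>p\<close> decides, since on \<open>p\<close> itself the two flips agree (\<open>homogeneity\<close>). This real is
eventually equal to \<open>c\<close>. Hence every property, with numbers as parameters, of the element that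
represents the class of the complement is shared by the element that represents the class of \<open>c\<close>.
Such properties tell any two numbers or sets of numbers apart, so the two elements coincide, and
with them the two classes (\<open>not_homogeneous\<close>).

What remains is to produce a model of \<open>SOA\<close> with such a \<open>c\<close> in it. The ground is the full power set
of the numbers. Forcing is defined for formulas of second-order arithmetic, with quantifiers
ranging over all names for sets of numbers. As there are uncountably many names, no real is generic
for all of them, so a countable family is chosen that is closed under Skolem functions for the
forcing relation and under the names demanded by comprehension and choice
(\<open>countable_closed_names\<close>). A real \<open>c\<close> generic for this family exists (\<open>generic_real_exists\<close>). The
values of the names at \<open>c\<close>, together with the standard numbers, form a model whose truths are
those forced by initial segments of \<open>c\<close> (\<open>truth\<close>), and which satisfies \<open>SOA\<close>
(\<open>generic_model_models_SOA\<close>). Numbers being standard, all the elementary axioms of arithmetic are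
immediate. The model is countable, so its domain embeds into any infinite type.

In the set model it has to be shown that the class of a real \<open>C\<close> is a set. For each \<open>k\<close> only
finitely many reals agree with \<open>C\<close> from \<open>k\<close> on, so they form a set, and the class is the union of
these sets over any unbounded set of numbers. Such an index set is found among the consequences of
infinity and collection, by looking at the places where the elements of an infinite set differ
(\<open>set_with_infinitely_many_numbers\<close>); this spares a recursion inside the set model.
\<close>

section \<open>Formulas under renaming and translation\<close>

lemma finite_fv: "finite (fv \<phi>)"
  by (induction \<phi>) auto

lemma sat_cong: "(\<And>i. i \<in> fv \<phi> \<Longrightarrow> e i = e' i) \<Longrightarrow> sat A e \<phi> = sat A e' \<phi>"
proof (induction \<phi> arbitrary: e e')
  case (Rel r xs)
  then have "map e xs = map e' xs" by simp
  then show ?case by (metis sat.simps(2))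
next
  case (Conj \<phi> \<psi>)
  then show ?case by (metis UnCI fv.simps(4) sat.simps(4))
next
  case (FAll x \<phi>)
  have "sat A (e(x := a)) \<phi> = sat A (e'(x := a)) \<phi>" for a
    by (rule FAll.IH) (use FAll.prems in auto)
  then show ?case by simp
next
  case (Neg \<phi>)
  then show ?case by (metis fv.simps(3) sat.simps(3))
qed simp

text \<open>Bound variables may clash with the images of free ones under \<open>f\<close>, so the substitution is built
together with a fresh choice of bound variables.\<close>

lemma renaming:
  fixes \<phi> :: "'r fm" and f :: "nat \<Rightarrow> nat"
  shows "\<exists>\<phi>'. (\<forall>ar. wf_fm ar \<phi>' = wf_fm ar \<phi>) \<and>
    (\<forall>(A :: ('r, 'a) struct) e. sat A e \<phi>' = sat A (\<lambda>i. e (f i)) \<phi>)"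
proof (induction \<phi> arbitrary: f)
  case (Eq x y)
  show ?case by (rule exI[of _ "f x \<^bold>= f y"]) simp
next
  case (Rel r xs)
  show ?case by (rule exI[of _ "Rel r (map f xs)"]) (simp add: comp_def)
next
  case (Neg \<phi>)
  then obtain \<phi>' where "\<forall>ar. wf_fm ar \<phi>' = wf_fm ar \<phi>"
    "\<forall>(A :: ('r, 'a) struct) e. sat A e \<phi>' = sat A (\<lambda>i. e (f i)) \<phi>" by blast
  then show ?case by (intro exI[of _ "\<^bold>\<not> \<phi>'"]) simp
next
  case (Conj \<phi> \<psi>)
  obtain \<phi>' where "\<forall>ar. wf_fm ar \<phi>' = wf_fm ar \<phi>"
    "\<forall>(A :: ('r, 'a) struct) e. sat A e \<phi>' = sat A (\<lambda>i. e (f i)) \<phi>" using Conj(1) by blast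
  moreover obtain \<psi>' where "\<forall>ar. wf_fm ar \<psi>' = wf_fm ar \<psi>"
    "\<forall>(A :: ('r, 'a) struct) e. sat A e \<psi>' = sat A (\<lambda>i. e (f i)) \<psi>" using Conj(2) by blast
  ultimately show ?case by (intro exI[of _ "\<phi>' \<^bold>\<and> \<psi>'"]) simp
next
  case (FAll x \<phi>)
  have "finite (f ` fv \<phi>)" by (simp add: finite_fv)
  then obtain z where z: "z \<notin> f ` fv \<phi>" using ex_new_if_finite[OF infinite_UNIV_nat] by blast
  obtain \<phi>' where \<phi>': "\<forall>ar. wf_fm ar \<phi>' = wf_fm ar \<phi>"
    "\<forall>(A :: ('r, 'a) struct) e. sat A e \<phi>' = sat A (\<lambda>i. e ((f(x := z)) i)) \<phi>" using FAll by blast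
  have "sat A (\<lambda>i. (e(z := a)) ((f(x := z)) i)) \<phi> = sat A ((\<lambda>i. e (f i))(x := a)) \<phi>"
    for A :: "('r, 'a) struct" and e a
    by (rule sat_cong) (use z in auto)
  then show ?case using \<phi>' by (intro exI[of _ "\<^bold>\<forall>z. \<phi>'"]) (simp del: fun_upd_apply)
qed

text \<open>A direct translation leaves the domain alone, so replacing each atomic formula by its (renamed)
translation is enough to translate all formulas.\<close>

lemma translate_formula:
  assumes t: "direct_translation S T t" and "wf_fm (arity S) \<phi>"
  shows "\<exists>\<phi>'. wf_fm (arity T) \<phi>' \<and>
    (\<forall>(A :: ('t, 'a) struct) e. range e \<subseteq> Dom A \<longrightarrow> sat A e \<phi>' = sat (induced S t A) e \<phi>)"
  using assms(2)
proof (induction \<phi>)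
  case (Eq x y)
  show ?case by (rule exI[of _ "x \<^bold>= y"]) simp
next
  case (Rel r xs)
  obtain \<phi>' where \<phi>': "\<forall>ar. wf_fm ar \<phi>' = wf_fm ar (t r)"
    "\<forall>(A :: ('t, 'a) struct) e. sat A e \<phi>' = sat A (\<lambda>i. e (xs ! i)) (t r)"
    using renaming by blast
  have "sat A (\<lambda>i. e (xs ! i)) (t r) = sat A ((!) (map e xs)) (t r)" for A :: "('t, 'a) struct" and e
    by (rule sat_cong) (use t Rel in \<open>fastforce simp: direct_translation_def\<close>)
  then have "sat A e \<phi>' = sat (induced S t A) e (Rel r xs)" if "range e \<subseteq> Dom A" for A :: "('t, 'a) struct" and e
    using that \<phi>' Rel by (auto simp: induced_def tuples_def)
  then show ?case using \<phi>' t by (intro exI[of _ \<phi>']) (auto simp: direct_translation_def)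
next
  case (Neg \<phi>)
  then obtain \<phi>' where "wf_fm (arity T) \<phi>'"
    "\<forall>(A :: ('t, 'a) struct) e. range e \<subseteq> Dom A \<longrightarrow> sat A e \<phi>' = sat (induced S t A) e \<phi>" by auto
  then show ?case by (intro exI[of _ "\<^bold>\<not> \<phi>'"]) simp
next
  case (Conj \<phi> \<psi>)
  obtain \<phi>' where "wf_fm (arity T) \<phi>'"
    "\<forall>(A :: ('t, 'a) struct) e. range e \<subseteq> Dom A \<longrightarrow> sat A e \<phi>' = sat (induced S t A) e \<phi>"
    using Conj by auto
  moreover obtain \<psi>' where "wf_fm (arity T) \<psi>'"
    "\<forall>(A :: ('t, 'a) struct) e. range e \<subseteq> Dom A \<longrightarrow> sat A e \<psi>' = sat (induced S t A) e \<psi>"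
    using Conj by auto
  ultimately show ?case by (intro exI[of _ "\<phi>' \<^bold>\<and> \<psi>'"]) simp
next
  case (FAll x \<phi>)
  then obtain \<phi>' where \<phi>': "wf_fm (arity T) \<phi>'"
    "\<forall>(A :: ('t, 'a) struct) e. range e \<subseteq> Dom A \<longrightarrow> sat A e \<phi>' = sat (induced S t A) e \<phi>" by auto
  have "range (e(x := a)) \<subseteq> D" if "range e \<subseteq> D" "a \<in> D" for e :: "nat \<Rightarrow> 'a" and a D
    using that by auto
  with \<phi>' show ?case by (intro exI[of _ "\<^bold>\<forall>x. \<phi>'"]) (auto simp: induced_def)
qed

section \<open>Transport of definitional equivalence along injections\<close>

definition map_struct :: "('a \<Rightarrow> 'b) \<Rightarrow> ('r, 'a) struct \<Rightarrow> ('r, 'b) struct" where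
  "map_struct h A = \<lparr>Dom = h ` Dom A, Rels = (\<lambda>r. map h ` Rels A r)\<rparr>"

lemma map_in_map_image_iff:
  assumes "inj_on h D" "set xs \<subseteq> D" "\<forall>ys \<in> R. set ys \<subseteq> D"
  shows "map h xs \<in> map h ` R \<longleftrightarrow> xs \<in> R"
proof
  assume "map h xs \<in> map h ` R"
  then obtain ys where ys: "map h xs = map h ys" "ys \<in> R" by blast
  then have "inj_on h (set xs \<union> set ys)" using assms by (meson inj_on_subset le_sup_iff)
  then show "xs \<in> R" using ys inj_on_map_eq_map by blast
qed simp

lemma sat_map_struct:
  assumes "inj_on h (Dom A)" "\<forall>r. \<forall>xs \<in> Rels A r. set xs \<subseteq> Dom A" "e ` fv \<phi> \<subseteq> Dom A"
  shows "sat (map_struct h A) (h \<circ> e) \<phi> = sat A e \<phi>"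
  using assms(3)
proof (induction \<phi> arbitrary: e)
  case (Eq x y)
  then show ?case using assms(1) by (auto simp: inj_on_eq_iff)
next
  case (Rel r xs)
  show ?case
    using map_in_map_image_iff[OF assms(1), of "map e xs" "Rels A r"] assms(2) Rel
    by (simp add: map_struct_def comp_def)
next
  case (FAll x \<phi>)
  have "sat (map_struct h A) ((\<lambda>i. h (e i))(x := h a)) \<phi> = sat A (e(x := a)) \<phi>" if "a \<in> Dom A" for a
  proof -
    have "sat (map_struct h A) (h \<circ> e(x := a)) \<phi> = sat A (e(x := a)) \<phi>"
      by (rule FAll.IH) (use FAll.prems that in auto)
    moreover have "(\<lambda>i. h (e i))(x := h a) = h \<circ> e(x := a)" by auto
    ultimately show ?thesis by metis
  qed
  then have "(\<forall>b \<in> Dom (map_struct h A). sat (map_struct h A) ((\<lambda>i. h (e i))(x := b)) \<phi>) \<longleftrightarrow>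
      (\<forall>a \<in> Dom A. sat A (e(x := a)) \<phi>)" by (simp add: map_struct_def)
  then show ?case by (simp add: comp_def)
qed (auto simp: image_Un)

lemma models_Rels: "A \<in> models T \<Longrightarrow> \<forall>r. \<forall>xs \<in> Rels A r. set xs \<subseteq> Dom A"
  by (auto simp: models_def tuples_def)

lemma map_struct_models_iff:
  assumes h: "inj_on h (Dom A)" and R: "\<forall>r. Rels A r \<subseteq> tuples (Dom A) (arity T r)"
  shows "map_struct h A \<in> models T \<longleftrightarrow> A \<in> models T"
proof -
  have R': "\<forall>r. \<forall>xs \<in> Rels A r. set xs \<subseteq> Dom A" using R by (auto simp: tuples_def)
  have tup: "Rels (map_struct h A) r \<subseteq> tuples (Dom (map_struct h A)) (arity T r)" for r
    using R by (fastforce simp: tuples_def map_struct_def)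
  have "(\<forall>e. range e \<subseteq> Dom (map_struct h A) \<longrightarrow> sat (map_struct h A) e \<phi>) \<longleftrightarrow>
        (\<forall>e. range e \<subseteq> Dom A \<longrightarrow> sat A e \<phi>)" (is "?l \<longleftrightarrow> ?r") for \<phi>
  proof
    assume l: ?l
    show ?r
    proof (intro allI impI)
      fix e :: "nat \<Rightarrow> 'a" assume e: "range e \<subseteq> Dom A"
      then have "range (h \<circ> e) \<subseteq> Dom (map_struct h A)" by (auto simp: map_struct_def)
      then show "sat A e \<phi>" using l sat_map_struct[OF h R', of e \<phi>] e by blast
    qed
  next
    assume r: ?r
    show ?l
    proof (intro allI impI)
      fix e :: "nat \<Rightarrow> 'b" assume e: "range e \<subseteq> Dom (map_struct h A)"
      define d where "d = inv_into (Dom A) h \<circ> e"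
      have "e i \<in> h ` Dom A" for i using e by (auto simp: map_struct_def)
      then have "h (d i) = e i" "d i \<in> Dom A" for i
        by (simp_all add: d_def f_inv_into_f inv_into_into)
      then have "e = h \<circ> d" "range d \<subseteq> Dom A" by auto
      then show "sat (map_struct h A) e \<phi>" using r sat_map_struct[OF h R', of d \<phi>] by blast
    qed
  qed
  then show ?thesis using R tup by (auto simp: models_def map_struct_def)
qed

lemma induced_map_struct:
  assumes h: "inj_on h (Dom A)" and R: "\<forall>r. \<forall>xs \<in> Rels A r. set xs \<subseteq> Dom A"
    and t: "direct_translation S T t"
  shows "induced S t (map_struct h A) = map_struct h (induced S t A)"
proof -
  have eq: "sat (map_struct h A) ((!) (map h xs)) (t r) = sat A ((!) xs) (t r)"
    if xs: "xs \<in> tuples (Dom A) (arity S r)" for xs r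
  proof -
    have fv: "i < length xs" if "i \<in> fv (t r)" for i
      using that t xs by (auto simp: direct_translation_def tuples_def)
    have "sat (map_struct h A) ((!) (map h xs)) (t r) = sat (map_struct h A) (h \<circ> (!) xs) (t r)"
      by (rule sat_cong) (simp add: fv)
    also have "\<dots> = sat A ((!) xs) (t r)"
    proof (rule sat_map_struct[OF h R])
      show "(!) xs ` fv (t r) \<subseteq> Dom A"
        using fv xs by (fastforce simp: tuples_def subset_iff)
    qed
    finally show ?thesis .
  qed
  have tup: "tuples (h ` Dom A) n = map h ` tuples (Dom A) n" for n
  proof (intro equalityI subsetI)
    fix ys assume "ys \<in> tuples (h ` Dom A) n"
    then have "ys \<in> map h ` lists (Dom A)" "length ys = n"
      by (auto simp: tuples_def lists_image[symmetric])
    then show "ys \<in> map h ` tuples (Dom A) n" by (auto simp: tuples_def)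
  qed (force simp: tuples_def)
  have "{ys \<in> tuples (h ` Dom A) (arity S r). sat (map_struct h A) ((!) ys) (t r)} =
    map h ` {xs \<in> tuples (Dom A) (arity S r). sat A ((!) xs) (t r)}" for r
    unfolding tup using eq by auto
  then show ?thesis by (simp add: induced_def map_struct_def)
qed

lemma map_struct_inject:
  fixes A B :: "('r, 'a) struct"
  assumes h: "inj_on h (Dom A)" and "Dom A = Dom B"
    and "\<forall>r. \<forall>xs \<in> Rels A r. set xs \<subseteq> Dom A" "\<forall>r. \<forall>xs \<in> Rels B r. set xs \<subseteq> Dom A"
    and eq: "map_struct h A = map_struct h B"
  shows "A = B"
proof -
  have "Rels A r = Rels B r" for r
  proof -
    have "map h ` Rels A r = map h ` Rels B r" using eq by (metis map_struct_def struct.select_convs(2))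
    moreover have "inj_on (map h) (lists (Dom A))"
      using h by (rule inj_on_mapI[OF inj_on_subset]) auto
    ultimately show ?thesis
      using assms(3,4) by (subst (asm) inj_on_image_eq_iff) (auto simp: subset_iff)
  qed
  then show ?thesis using assms(2) by (cases A; cases B) auto
qed

text \<open>Definitional equivalence speaks of models with domains in one fixed type. An injection carries a
structure into that type; induced structures commute with the transport, and being a model is
invariant under it, so the conclusion can be pulled back to the original structure.\<close>

lemma definitionally_equivalent_embedded:
  fixes C :: "('t, 'b) struct" and h :: "'b \<Rightarrow> 'a"
  assumes "definitionally_equivalent TYPE('a) T S" and C: "C \<in> models T" and h: "inj_on h (Dom C)"
  obtains t s where "direct_translation S T t" "direct_translation T S s"
    "induced S t C \<in> models S" "induced T s (induced S t C) = C"
proof -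
  obtain t s where t: "direct_interpretation TYPE('a) S T t" and s: "direct_interpretation TYPE('a) T S s"
    and id: "\<forall>A :: ('t, 'a) struct \<in> models T. A = induced T s (induced S t A)"
    using assms(1) unfolding definitionally_equivalent_def by blast
  have dt: "direct_translation S T t" and ds: "direct_translation T S s"
    using t s by (auto simp: direct_interpretation_def)
  have Rt: "\<forall>r. Rels (induced U u A) r \<subseteq> tuples (Dom (induced U u A)) (arity U r)"
    for U :: "'u fo_theory" and u and A :: "('v, 'b) struct" by (auto simp: induced_def)
  then have Rs: "\<forall>r. \<forall>xs \<in> Rels (induced U u A) r. set xs \<subseteq> Dom (induced U u A)"
    for U :: "'u fo_theory" and u and A :: "('v, 'b) struct" by (force simp: tuples_def)
  have D[simp]: "Dom (induced U u A) = Dom A"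
    for U :: "'u fo_theory" and u and A :: "('v, 'b) struct" by (simp add: induced_def)
  have hC: "map_struct h C \<in> models T"
    using C h by (subst map_struct_models_iff) (auto simp: models_def)
  have comm: "induced S t (map_struct h C) = map_struct h (induced S t C)"
    by (rule induced_map_struct[OF h models_Rels[OF C] dt])
  have "induced S t (map_struct h C) \<in> models S"
    using t hC by (auto simp: direct_interpretation_def)
  then have m: "induced S t C \<in> models S"
    unfolding comm using h by (subst (asm) map_struct_models_iff) (auto simp: induced_def)
  have "map_struct h C = induced T s (map_struct h (induced S t C))"
    using id hC comm by metis
  also have "\<dots> = map_struct h (induced T s (induced S t C))"
    by (rule induced_map_struct[OF _ models_Rels[OF m] ds]) (simp add: h induced_def)
  finally have "C = induced T s (induced S t C)"
    by (intro map_struct_inject[OF h]) (use models_Rels[OF C] in \<open>auto simp: induced_def tuples_def\<close>)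
  then show ?thesis using that dt ds m by metis
qed

section \<open>Models of second-order arithmetic with standard numbers\<close>

text \<open>The structures below have domain \<open>UNIV <+> \<S>\<close>: numbers are tagged by \<open>Inl\<close>, sets by \<open>Inr\<close>.\<close>

primrec arith_rel :: "soa_sym \<Rightarrow> (nat + nat set) list set" where
  "arith_rel NumS = {[Inl n] | n. True}"
| "arith_rel SetS = {[Inr X] | X. True}"
| "arith_rel ZeroS = {[Inl 0]}"
| "arith_rel OneS = {[Inl 1]}"
| "arith_rel AddS = {[Inl m, Inl n, Inl (m + n)] | m n. True}"
| "arith_rel MulS = {[Inl m, Inl n, Inl (m * n)] | m n. True}"
| "arith_rel LessS = {[Inl m, Inl n] | m n. m < n}"
| "arith_rel ElemS = {[Inl n, Inr X] | n X. n \<in> X}"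

definition omega_struct :: "nat set set \<Rightarrow> (soa_sym, nat + nat set) struct" where
  "omega_struct \<S> = \<lparr>Dom = UNIV <+> \<S>, Rels = (\<lambda>r. arith_rel r \<inter> lists (UNIV <+> \<S>))\<rparr>"

lemma Dom_omega_struct [simp]: "Dom (omega_struct \<S>) = UNIV <+> \<S>"
  by (simp add: omega_struct_def)

lemma ball_Plus [simp]: "(\<forall>a \<in> A <+> B. P a) \<longleftrightarrow> (\<forall>x \<in> A. P (Inl x)) \<and> (\<forall>y \<in> B. P (Inr y))"
  by auto

lemma Inl_Inr_in_Plus [simp]: "Inl x \<in> A <+> B \<longleftrightarrow> x \<in> A" "Inr y \<in> A <+> B \<longleftrightarrow> y \<in> B"
  by auto

lemma Rels_omega_struct [simp]:
  "[a] \<in> Rels (omega_struct \<S>) NumS \<longleftrightarrow> (\<exists>n. a = Inl n)"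
  "[a] \<in> Rels (omega_struct \<S>) SetS \<longleftrightarrow> (\<exists>X \<in> \<S>. a = Inr X)"
  "[a] \<in> Rels (omega_struct \<S>) ZeroS \<longleftrightarrow> a = Inl 0"
  "[a] \<in> Rels (omega_struct \<S>) OneS \<longleftrightarrow> a = Inl 1"
  "[a, b, c] \<in> Rels (omega_struct \<S>) AddS \<longleftrightarrow> (\<exists>m n. a = Inl m \<and> b = Inl n \<and> c = Inl (m + n))"
  "[a, b, c] \<in> Rels (omega_struct \<S>) MulS \<longleftrightarrow> (\<exists>m n. a = Inl m \<and> b = Inl n \<and> c = Inl (m * n))"
  "[a, b] \<in> Rels (omega_struct \<S>) LessS \<longleftrightarrow> (\<exists>m n. a = Inl m \<and> b = Inl n \<and> m < n)"
  "[a, b] \<in> Rels (omega_struct \<S>) ElemS \<longleftrightarrow> (\<exists>n. \<exists>X \<in> \<S>. a = Inl n \<and> b = Inr X \<and> n \<in> X)"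
  by (auto simp: omega_struct_def)

lemma sat_is_plus1 [simp]:
  "sat (omega_struct \<S>) e (is_plus1 n m) \<longleftrightarrow> (\<exists>k. e n = Inl k \<and> e m = Inl (Suc k))"
proof -
  have "n \<noteq> fresh [n, m]" "m \<noteq> fresh [n, m]" by (simp_all add: fresh_def)
  then show ?thesis by (auto simp: is_plus1_def Let_def)
qed

text \<open>The value of the coding that \<open>is_code\<close> defines.\<close>

definition pair_code :: "nat \<Rightarrow> nat \<Rightarrow> nat" where
  "pair_code i n = (i + n) * (i + n) + i"

lemma pair_code_eq_iff: "pair_code i n = pair_code j m \<longleftrightarrow> i = j \<and> n = m"
proof -
  have less: "pair_code i n < pair_code j m" if "i + n < j + m" for i n j m
  proof -
    have "pair_code i n < (i + n + 1) * (i + n + 1)" by (simp add: pair_code_def)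
    also have "\<dots> \<le> (j + m) * (j + m)" using that by (intro mult_le_mono) auto
    also have "\<dots> \<le> pair_code j m" by (simp add: pair_code_def)
    finally show ?thesis .
  qed
  show ?thesis
  proof
    assume eq: "pair_code i n = pair_code j m"
    then have "i + n = j + m" using less[of i n j m] less[of j m i n] by linarith
    then show "i = j \<and> n = m" using eq by (simp add: pair_code_def)
  qed simp
qed

lemma sat_is_code [simp]:
  "sat (omega_struct \<S>) e (is_code i n p) \<longleftrightarrow>
    (\<exists>j k. e i = Inl j \<and> e n = Inl k \<and> e p = Inl (pair_code j k))"
proof -
  let ?s = "fresh [i, n, p]"
  let ?q = "fresh [i, n, p, ?s]"
  have "?s \<noteq> i" "?s \<noteq> n" "?s \<noteq> p" "?q \<noteq> i" "?q \<noteq> n" "?q \<noteq> p" "?q \<noteq> ?s"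
    by (simp_all add: fresh_def)
  then show ?thesis by (auto simp: is_code_def Let_def pair_code_def)
qed

lemma sat_is_section [simp]:
  assumes "e n = Inl k" "e Z = Inr A" "e Y \<in> UNIV <+> \<S>" "A \<in> \<S>"
  shows "sat (omega_struct \<S>) e (is_section Z n Y) \<longleftrightarrow> e Y = Inr {i. pair_code i k \<in> A}"
proof -
  let ?i = "fresh [Z, n, Y]"
  let ?p = "fresh [Z, n, Y, ?i]"
  have "?i \<noteq> Z" "?i \<noteq> n" "?i \<noteq> Y" "?p \<noteq> Z" "?p \<noteq> n" "?p \<noteq> Y" "?p \<noteq> ?i"
    by (simp_all add: fresh_def)
  then show ?thesis using assms by (auto simp: is_section_def Let_def)
qed

text \<open>Numbers are standard, so only comprehension and choice make demands on the family of sets.\<close>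

lemma omega_struct_models_SOA:
  assumes compr: "\<And>\<phi> n e. wf_fm soa_arity \<phi> \<Longrightarrow> range e \<subseteq> UNIV <+> \<S> \<Longrightarrow>
      {m. sat (omega_struct \<S>) (e(n := Inl m)) \<phi>} \<in> \<S>"
    and choice: "\<And>\<phi> n Y e. wf_fm soa_arity \<phi> \<Longrightarrow> range e \<subseteq> UNIV <+> \<S> \<Longrightarrow> n \<noteq> Y \<Longrightarrow>
      \<forall>m. \<exists>X \<in> \<S>. sat (omega_struct \<S>) (e(n := Inl m, Y := Inr X)) \<phi> \<Longrightarrow>
      \<exists>Z \<in> \<S>. \<forall>m. {i. pair_code i m \<in> Z} \<in> \<S> \<and>
        sat (omega_struct \<S>) (e(n := Inl m, Y := Inr {i. pair_code i m \<in> Z})) \<phi>"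
  shows "omega_struct \<S> \<in> models SOA"
proof -
  have tup: "Rels (omega_struct \<S>) r \<subseteq> tuples (UNIV <+> \<S>) (soa_arity r)" for r
    by (cases r) (auto simp: omega_struct_def tuples_def)
  have "sat (omega_struct \<S>) e \<phi>" if "\<phi> \<in> SOA_axioms" and e: "range e \<subseteq> UNIV <+> \<S>" for \<phi> e
    using that(1)
  proof cases
    case (sorts x)
    have "e x \<in> UNIV <+> \<S>" using e by auto
    then show ?thesis using sorts by auto
  next
    case (extensionality X Y n)
    show ?thesis
    proof (cases "(\<exists>A \<in> \<S>. e X = Inr A) \<and> (\<exists>B \<in> \<S>. e Y = Inr B)")
      case True
      then obtain A B where "A \<in> \<S>" "e X = Inr A" "B \<in> \<S>" "e Y = Inr B" by blast
      moreover have "A = B \<or> (\<exists>k. k \<in> A \<and> k \<notin> B \<or> k \<in> B \<and> k \<notin> A)" by blast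
      ultimately show ?thesis using extensionality by auto
    qed (use extensionality in auto)
  next
    case (induction X n n')
    show ?thesis
    proof (cases "\<exists>A \<in> \<S>. e X = Inr A")
      case True
      then obtain A where "A \<in> \<S>" "e X = Inr A" by blast
      moreover have "0 \<notin> A \<or> (\<exists>k. k \<in> A \<and> Suc k \<notin> A) \<or> A = UNIV"
        using nat_induct[of "\<lambda>k. k \<in> A"] by blast
      ultimately show ?thesis using induction by auto
    qed (use induction in auto)
  next
    case (comprehension X n \<phi>)
    define A where "A = {m. sat (omega_struct \<S>) (e(n := Inl m)) \<phi>}"
    have "sat (omega_struct \<S>) (e(X := Inr A, n := Inl m)) \<phi> \<longleftrightarrow> m \<in> A" for m
      unfolding A_def mem_Collect_eq by (rule sat_cong) (use comprehension in auto)
    moreover have "A \<in> \<S>" unfolding A_def using compr comprehension e by blast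
    ultimately show ?thesis using comprehension by auto
  next
    case (choice n Y Z \<phi>)
    have drop: "sat (omega_struct \<S>) (e(Z := a, n := b, Y := c)) \<phi> \<longleftrightarrow>
        sat (omega_struct \<S>) (e(n := b, Y := c)) \<phi>" for a b c
      by (rule sat_cong) (use choice in auto)
    show ?thesis
    proof (cases "\<forall>m. \<exists>X \<in> \<S>. sat (omega_struct \<S>) (e(n := Inl m, Y := Inr X)) \<phi>")
      case True
      then obtain A where A: "A \<in> \<S>" "\<And>m. {i. pair_code i m \<in> A} \<in> \<S>"
        "\<And>m. sat (omega_struct \<S>) (e(n := Inl m, Y := Inr {i. pair_code i m \<in> A})) \<phi>"
        using assms(2)[OF choice(3) e] choice by (metis distinct_length_2_or_more)
      have "\<exists>X \<in> \<S>. sat (omega_struct \<S>) (e(Z := Inr A, n := Inl m, Y := Inr X)) (is_section Z n Y \<^bold>\<and> \<phi>)" for m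
        using A choice drop[of "Inr A" "Inl m"] by (intro bexI[of _ "{i. pair_code i m \<in> A}"]) auto
      then have "\<exists>A \<in> \<S>. \<forall>m. \<exists>X \<in> \<S>. sat (omega_struct \<S>) (e(Z := Inr A, n := Inl m, Y := Inr X)) (is_section Z n Y) \<and>
          sat (omega_struct \<S>) (e(Z := Inr A, n := Inl m, Y := Inr X)) \<phi>"
        using A(1) by auto
      then show ?thesis using choice by (simp del: sat_is_section) blast
    next
      case False
      then show ?thesis using choice by auto
    qed
  qed auto
  then show ?thesis using tup by (auto simp: models_def SOA_def Plus_def)
qed

section \<open>Cohen forcing over all names for reals\<close>

type_synonym cond = "bool list"

text \<open>Conditions are finite initial segments of a Cohen real; the extending condition \<open>q\<close> is the stronger
one.\<close>

definition extends :: "cond \<Rightarrow> cond \<Rightarrow> bool"  (infix \<open>\<preceq>\<close> 50) where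
  "p \<preceq> q \<longleftrightarrow> length p \<le> length q \<and> (\<forall>i < length p. p ! i = q ! i)"

lemma extends_refl [simp]: "p \<preceq> p"
  by (simp add: extends_def)

lemma extends_trans [trans]: "p \<preceq> q \<Longrightarrow> q \<preceq> r \<Longrightarrow> p \<preceq> r"
  by (auto simp: extends_def)

lemma take_extends: "p \<preceq> q \<Longrightarrow> k \<le> length p \<Longrightarrow> take k q = take k p"
  by (auto simp: extends_def intro!: nth_equalityI)

definition stem :: "(nat \<Rightarrow> bool) \<Rightarrow> nat \<Rightarrow> cond" where
  "stem c k = map c [0..<k]"

lemma length_stem [simp]: "length (stem c k) = k"
  by (simp add: stem_def)

lemma stem_nth [simp]: "i < k \<Longrightarrow> stem c k ! i = c i"
  by (simp add: stem_def)

lemma stem_extends_stem [simp]: "stem c k \<preceq> stem c l \<longleftrightarrow> k \<le> l"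
  by (auto simp: extends_def)

lemma take_stem: "k \<le> l \<Longrightarrow> take k (stem c l) = stem c k"
  by (auto intro!: nth_equalityI)

text \<open>Genericity takes the form that \<open>c\<close> either meets \<open>D\<close> or has
an initial segment beyond which \<open>D\<close> is avoided altogether, so that applying it takes no density
argument. The real is the limit of a chain of conditions that enters each set whenever it still can.\<close>

lemma generic_real_exists:
  fixes \<D> :: "cond set set"
  assumes "countable \<D>"
  obtains c where "\<And>D. D \<in> \<D> \<Longrightarrow> \<exists>k. stem c k \<in> D \<or> (\<forall>q. stem c k \<preceq> q \<longrightarrow> q \<notin> D)"
proof -
  define D where "D = from_nat_into \<D>"
  define next_cond where "next_cond = (\<lambda>n p. if \<exists>q. p \<preceq> q \<and> q \<in> D n then SOME q. p \<preceq> q \<and> q \<in> D n else p)"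
  have nxt: "p \<preceq> next_cond n p" "next_cond n p \<in> D n \<or> (\<forall>q. next_cond n p \<preceq> q \<longrightarrow> q \<notin> D n)" for n p
    using someI_ex[of "\<lambda>q. p \<preceq> q \<and> q \<in> D n"] by (auto simp: next_cond_def)
  define p where "p = rec_nat [] next_cond"
  have p_Suc: "p (Suc n) = next_cond n (p n)" for n by (simp add: p_def)
  have mono: "p m \<preceq> p n" if "m \<le> n" for m n
    using that by (induction rule: dec_induct) (auto simp: p_Suc intro: extends_trans nxt(1))
  define c where "c = (\<lambda>i. \<exists>n. i < length (p n) \<and> p n ! i)"
  have "p n ! i = c i" if "i < length (p n)" for i n
  proof -
    have "p m ! i = p n ! i" if "i < length (p m)" for m
      using mono[of m n] mono[of n m] nat_le_linear[of m n] that \<open>i < length (p n)\<close>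
      unfolding extends_def by metis
    then show ?thesis using that unfolding c_def by blast
  qed
  then have stem: "stem c (length (p n)) = p n" for n
    by (intro nth_equalityI) auto
  show ?thesis
  proof
    fix E assume "E \<in> \<D>"
    then obtain n where "E = D n" using assms from_nat_into_surj unfolding D_def by metis
    then show "\<exists>k. stem c k \<in> E \<or> (\<forall>q. stem c k \<preceq> q \<longrightarrow> q \<notin> E)"
      using nxt(2)[of n "p n"] stem[of "Suc n"] p_Suc[of n] by metis
  qed
qed

text \<open>The regular open set generated by \<open>D\<close>: the conditions below which \<open>D\<close> is dense.\<close>

definition dense_closure :: "cond set \<Rightarrow> cond set" where
  "dense_closure D = {p. \<forall>q. p \<preceq> q \<longrightarrow> (\<exists>r. q \<preceq> r \<and> r \<in> D)}"

lemma dense_closure_upward: "p \<in> dense_closure D \<Longrightarrow> p \<preceq> q \<Longrightarrow> q \<in> dense_closure D"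
  unfolding dense_closure_def by (blast intro: extends_trans)

lemma dense_closure_idem [simp]: "dense_closure (dense_closure D) = dense_closure D"
proof
  show "dense_closure (dense_closure D) \<subseteq> dense_closure D"
    unfolding dense_closure_def by (blast intro: extends_trans extends_refl)
  show "dense_closure D \<subseteq> dense_closure (dense_closure D)"
    using dense_closure_upward extends_refl unfolding dense_closure_def[of "dense_closure D"] by blast
qed

lemma dense_closure_trivial [simp]: "dense_closure {} = {}" "dense_closure UNIV = UNIV"
  unfolding dense_closure_def using extends_refl by blast+

lemma dense_closure_superset:
  "(\<And>q. p \<preceq> q \<Longrightarrow> q \<in> D) \<Longrightarrow> p \<in> dense_closure D"
  unfolding dense_closure_def using extends_refl by blast

text \<open>A set name \<open>x\<close> promises that \<open>n\<close> is an element if some condition in \<open>x n\<close> is met. The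
sets \<open>x n\<close> are arbitrary because they are always read through \<open>dense_closure\<close>. A number is its own only name: which
number witnesses an existential statement is decided by the generic real.\<close>

datatype name = Nat_name nat | Set_name "nat \<Rightarrow> cond set"

primrec forces_eq :: "name \<Rightarrow> name \<Rightarrow> cond \<Rightarrow> bool" where
  "forces_eq (Nat_name m) b p \<longleftrightarrow> b = Nat_name m"
| "forces_eq (Set_name x) b p \<longleftrightarrow> (\<exists>y. b = Set_name y \<and>
    (\<forall>q. p \<preceq> q \<longrightarrow> (\<forall>n. q \<in> dense_closure (x n) \<longleftrightarrow> q \<in> dense_closure (y n))))"

text \<open>The empty set is a dummy value: apart from membership, the relations of arithmetic depend on a set
only through its being a set.\<close>

primrec sort_of :: "name \<Rightarrow> nat + nat set" where
  "sort_of (Nat_name n) = Inl n"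
| "sort_of (Set_name x) = Inr {}"

definition forces_rel :: "soa_sym \<Rightarrow> name list \<Rightarrow> cond \<Rightarrow> bool" where
  "forces_rel r as p \<longleftrightarrow> (if r = ElemS
     then \<exists>n x. as = [Nat_name n, Set_name x] \<and> p \<in> dense_closure (x n)
     else map sort_of as \<in> arith_rel r)"

primrec forces :: "soa_sym fm \<Rightarrow> (nat \<Rightarrow> name) \<Rightarrow> cond \<Rightarrow> bool" where
  "forces (x \<^bold>= y) e p \<longleftrightarrow> forces_eq (e x) (e y) p"
| "forces (Rel r xs) e p \<longleftrightarrow> forces_rel r (map e xs) p"
| "forces (\<^bold>\<not> \<phi>) e p \<longleftrightarrow> (\<forall>q. p \<preceq> q \<longrightarrow> \<not> forces \<phi> e q)"
| "forces (\<phi> \<^bold>\<and> \<psi>) e p \<longleftrightarrow> forces \<phi> e p \<and> forces \<psi> e p"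
| "forces (\<^bold>\<forall>x. \<phi>) e p \<longleftrightarrow> (\<forall>a. forces \<phi> (e(x := a)) p)"

lemma forces_cong: "(\<And>i. i \<in> fv \<phi> \<Longrightarrow> e i = e' i) \<Longrightarrow> forces \<phi> e = forces \<phi> e'"
proof (induction \<phi> arbitrary: e e')
  case (Rel r xs)
  then have "map e xs = map e' xs" by simp
  then show ?case by (intro ext) (metis forces.simps(2))
next
  case (Conj \<phi> \<psi>)
  have "forces \<phi> e = forces \<phi> e'" "forces \<psi> e = forces \<psi> e'"
    by (rule Conj.IH; use Conj.prems in simp)+
  then show ?case by (intro ext) simp
next
  case (FAll x \<phi>)
  have "forces \<phi> (e(x := a)) = forces \<phi> (e'(x := a))" for a
    by (rule FAll.IH) (use FAll.prems in auto)
  then show ?case by (intro ext) simp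
next
  case (Neg \<phi>)
  have "forces \<phi> e = forces \<phi> e'" by (rule Neg.IH) (use Neg.prems in simp)
  then show ?case by (intro ext) simp
qed auto

lemma dense_closure_forces_eq: "dense_closure {p. forces_eq a b p} = {p. forces_eq a b p}"
proof (cases a)
  case (Nat_name m)
  then show ?thesis by (cases "b = Nat_name m") auto
next
  case (Set_name x)
  show ?thesis
  proof (cases b)
    case (Set_name y)
    have "q \<in> dense_closure (x n) \<longleftrightarrow> q \<in> dense_closure (y n)"
      if p: "p \<in> dense_closure {p. forces_eq a b p}" and "p \<preceq> q" for n p q
    proof -
      have "\<exists>r. q' \<preceq> r \<and> (\<forall>n. r \<in> dense_closure (x n) \<longleftrightarrow> r \<in> dense_closure (y n))" if "q \<preceq> q'" for q'
      proof -
        obtain r where "q' \<preceq> r" "forces_eq a b r"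
          using p \<open>p \<preceq> q\<close> \<open>q \<preceq> q'\<close> extends_trans unfolding dense_closure_def by blast
        then show ?thesis using \<open>a = Set_name x\<close> Set_name by (auto intro!: exI[of _ r])
      qed
      note agree = this
      have "q \<in> dense_closure (dense_closure (y n))" if "q \<in> dense_closure (x n)"
        using agree dense_closure_upward[OF that] extends_trans
        unfolding dense_closure_def[of "dense_closure (y n)"] by blast
      moreover have "q \<in> dense_closure (dense_closure (x n))" if "q \<in> dense_closure (y n)"
        using agree dense_closure_upward[OF that] extends_trans
        unfolding dense_closure_def[of "dense_closure (x n)"] by blast
      ultimately show ?thesis by auto
    qed
    then have "dense_closure {p. forces_eq a b p} \<subseteq> {p. forces_eq a b p}"
      using \<open>a = Set_name x\<close> Set_name by auto
    moreover have "{p. forces_eq a b p} \<subseteq> dense_closure {p. forces_eq a b p}"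
      using \<open>a = Set_name x\<close> Set_name by (intro subsetI dense_closure_superset) (auto intro: extends_trans)
    ultimately show ?thesis by blast
  qed (auto simp: \<open>a = Set_name x\<close>)
qed

text \<open>Forcing is weak forcing: a condition forces whatever is forced densely below it. This makes the
forced sets eligible as values of names, and it turns failure to force \<open>\<phi>\<close> into an extension that
forces \<open>\<^bold>\<not> \<phi>\<close>.\<close>

lemma dense_closure_forces: "dense_closure {p. forces \<phi> e p} = {p. forces \<phi> e p}"
proof (induction \<phi> arbitrary: e)
  case (Eq x y)
  show ?case by (simp add: dense_closure_forces_eq)
next
  case (Rel r xs)
  show ?case
  proof (cases "\<exists>n x. r = ElemS \<and> map e xs = [Nat_name n, Set_name x]")
    case True
    then obtain n x where "r = ElemS" "map e xs = [Nat_name n, Set_name x]" by auto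
    then have "{p. forces (Rel r xs) e p} = dense_closure (x n)" by (simp add: forces_rel_def)
    then show ?thesis by simp
  next
    case False
    then have "{p. forces (Rel r xs) e p} = {} \<or> {p. forces (Rel r xs) e p} = UNIV"
      by (auto simp: forces_rel_def)
    then show ?thesis by (elim disjE) (simp_all only: dense_closure_trivial)
  qed
next
  case (Neg \<phi>)
  show ?case
  proof
    show "dense_closure {p. forces (\<^bold>\<not> \<phi>) e p} \<subseteq> {p. forces (\<^bold>\<not> \<phi>) e p}"
    proof (rule subsetI, simp, intro allI impI notI)
      fix p q assume p: "p \<in> dense_closure {p. \<forall>q. p \<preceq> q \<longrightarrow> \<not> forces \<phi> e q}" and "p \<preceq> q" "forces \<phi> e q"
      then obtain r where "q \<preceq> r" "\<not> forces \<phi> e r" unfolding dense_closure_def by force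
      moreover have "q \<in> dense_closure {p. forces \<phi> e p}" using Neg \<open>forces \<phi> e q\<close> by blast
      ultimately show False using dense_closure_upward Neg by blast
    qed
  qed (auto intro!: dense_closure_superset intro: extends_trans)
next
  case (Conj \<phi> \<psi>)
  have "p \<in> dense_closure {p. forces \<phi> e p}" "p \<in> dense_closure {p. forces \<psi> e p}"
    if "p \<in> dense_closure {p. forces (\<phi> \<^bold>\<and> \<psi>) e p}" for p
    using that unfolding dense_closure_def by auto
  then have "dense_closure {p. forces (\<phi> \<^bold>\<and> \<psi>) e p} \<subseteq> {p. forces (\<phi> \<^bold>\<and> \<psi>) e p}"
    unfolding Conj mem_Collect_eq subset_iff forces.simps by blast
  moreover have "forces (\<phi> \<^bold>\<and> \<psi>) e q" if "forces (\<phi> \<^bold>\<and> \<psi>) e p" "p \<preceq> q" for p q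
    using that dense_closure_upward[of p "{p. forces \<phi> e p}" q] dense_closure_upward[of p "{p. forces \<psi> e p}" q]
    unfolding Conj mem_Collect_eq forces.simps by blast
  then have "\<And>p. forces (\<phi> \<^bold>\<and> \<psi>) e p \<Longrightarrow> p \<in> dense_closure {p. forces (\<phi> \<^bold>\<and> \<psi>) e p}"
    using dense_closure_superset by (metis mem_Collect_eq)
  then have "{p. forces (\<phi> \<^bold>\<and> \<psi>) e p} \<subseteq> dense_closure {p. forces (\<phi> \<^bold>\<and> \<psi>) e p}"
    by blast
  ultimately show ?case by blast
next
  case (FAll x \<phi>)
  have "p \<in> dense_closure {p. forces \<phi> (e(x := a)) p}"
    if "p \<in> dense_closure {p. forces (\<^bold>\<forall>x. \<phi>) e p}" for p a
    using that unfolding dense_closure_def by auto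
  then have "dense_closure {p. forces (\<^bold>\<forall>x. \<phi>) e p} \<subseteq> {p. forces (\<^bold>\<forall>x. \<phi>) e p}"
    unfolding FAll mem_Collect_eq subset_iff forces.simps by blast
  moreover have "forces \<phi> (e(x := a)) q" if "forces \<phi> (e(x := a)) p" "p \<preceq> q" for p q a
    using that dense_closure_upward[of p "{p. forces \<phi> (e(x := a)) p}" q]
    unfolding FAll mem_Collect_eq by blast
  then have up: "forces (\<^bold>\<forall>x. \<phi>) e q" if "forces (\<^bold>\<forall>x. \<phi>) e p" "p \<preceq> q" for p q
    using that unfolding forces.simps by blast
  have "\<And>p. forces (\<^bold>\<forall>x. \<phi>) e p \<Longrightarrow> p \<in> dense_closure {p. forces (\<^bold>\<forall>x. \<phi>) e p}"
    using dense_closure_superset up by (metis mem_Collect_eq)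
  then have "{p. forces (\<^bold>\<forall>x. \<phi>) e p} \<subseteq> dense_closure {p. forces (\<^bold>\<forall>x. \<phi>) e p}"
    by blast
  ultimately show ?case by blast
qed

lemma forces_upward: "forces \<phi> e p \<Longrightarrow> p \<preceq> q \<Longrightarrow> forces \<phi> e q"
  using dense_closure_upward dense_closure_forces by blast

lemma not_forces: "\<not> forces \<phi> e p \<Longrightarrow> \<exists>q. p \<preceq> q \<and> forces (\<^bold>\<not> \<phi>) e q"
  using dense_closure_forces[of \<phi> e] unfolding dense_closure_def by force

section \<open>Homogeneity of Cohen forcing\<close>

text \<open>The automorphism of the conditions that flips the bits in \<open>A\<close>.\<close>

definition flip :: "nat set \<Rightarrow> cond \<Rightarrow> cond" where
  "flip A p = map (\<lambda>i. p ! i \<noteq> (i \<in> A)) [0..<length p]"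

lemma length_flip [simp]: "length (flip A p) = length p"
  by (simp add: flip_def)

lemma flip_nth [simp]: "i < length p \<Longrightarrow> flip A p ! i \<longleftrightarrow> p ! i \<noteq> (i \<in> A)"
  by (simp add: flip_def)

lemma flip_flip [simp]: "flip A (flip A p) = p"
  by (auto intro!: nth_equalityI)

lemma flip_extends_flip [simp]: "flip A p \<preceq> flip A q \<longleftrightarrow> p \<preceq> q"
  by (auto simp: extends_def)

lemma all_extends_flip: "(\<forall>q. p \<preceq> q \<longrightarrow> P (flip A q)) \<longleftrightarrow> (\<forall>q. flip A p \<preceq> q \<longrightarrow> P q)"
  by (metis flip_flip flip_extends_flip)

lemma dense_closure_flip: "p \<in> dense_closure {q. flip A q \<in> D} \<longleftrightarrow> flip A p \<in> dense_closure D"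
proof -
  have "flip A p \<in> dense_closure D \<longleftrightarrow> (\<forall>q. flip A p \<preceq> flip A q \<longrightarrow> (\<exists>r. flip A q \<preceq> flip A r \<and> flip A r \<in> D))"
    unfolding dense_closure_def mem_Collect_eq by (metis flip_flip)
  then show ?thesis by (simp add: dense_closure_def)
qed

primrec flip_name :: "nat set \<Rightarrow> name \<Rightarrow> name" where
  "flip_name A (Nat_name n) = Nat_name n"
| "flip_name A (Set_name x) = Set_name (\<lambda>n. {p. flip A p \<in> x n})"

lemma flip_name_flip_name [simp]: "flip_name A (flip_name A a) = a"
  by (cases a) auto

lemma forces_eq_flip: "forces_eq (flip_name A a) (flip_name A b) p \<longleftrightarrow> forces_eq a b (flip A p)"
proof (cases a; cases b)
  fix x y assume "a = Set_name x" "b = Set_name y"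
  then show ?thesis
    using all_extends_flip[of p "\<lambda>q. \<forall>n. q \<in> dense_closure (x n) \<longleftrightarrow> q \<in> dense_closure (y n)" A]
    by (simp add: dense_closure_flip)
qed auto

lemma sort_of_flip_name [simp]: "sort_of (flip_name A a) = sort_of a"
  by (cases a) auto

lemma flip_name_eq_iff: "flip_name A a = b \<longleftrightarrow> a = flip_name A b"
  by (metis flip_name_flip_name)

lemma forces_rel_flip: "forces_rel r (map (flip_name A) as) p \<longleftrightarrow> forces_rel r as (flip A p)"
proof -
  have "map (flip_name A) as = [Nat_name n, Set_name x] \<longleftrightarrow>
      as = [Nat_name n, Set_name (\<lambda>n. {p. flip A p \<in> x n})]" for n x
    by (auto simp: flip_name_eq_iff map_eq_Cons_conv)
  moreover have "(\<exists>x. as = [Nat_name n, Set_name (\<lambda>n. {p. flip A p \<in> x n})] \<and> p \<in> dense_closure (x n)) \<longleftrightarrow>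
      (\<exists>x. as = [Nat_name n, Set_name x] \<and> flip A p \<in> dense_closure (x n))" (is "?l \<longleftrightarrow> ?r") for n
  proof
    assume ?l
    then show ?r by (auto simp flip: dense_closure_flip)
  next
    assume ?r
    then obtain x where "as = [Nat_name n, Set_name x]" "flip A p \<in> dense_closure (x n)" by blast
    then show ?l by (intro exI[of _ "\<lambda>n. {p. flip A p \<in> x n}"]) (simp add: dense_closure_flip)
  qed
  ultimately show ?thesis by (auto simp: forces_rel_def comp_def)
qed

text \<open>Since quantifiers range over all names, and \<open>flip_name A\<close> permutes them, the automorphism respects
forcing.\<close>

lemma forces_flip: "forces \<phi> (\<lambda>i. flip_name A (e i)) p \<longleftrightarrow> forces \<phi> e (flip A p)"
proof (induction \<phi> arbitrary: e p)
  case (Eq x y)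
  show ?case by (simp add: forces_eq_flip)
next
  case (Rel r xs)
  show ?case using forces_rel_flip[of r A "map e xs" p] by (simp add: comp_def)
next
  case (Neg \<phi>)
  show ?case using Neg all_extends_flip[of p "\<lambda>q. \<not> forces \<phi> e q" A] by simp
next
  case (FAll x \<phi>)
  have "(\<lambda>i. flip_name A (e i))(x := flip_name A a) = (\<lambda>i. flip_name A ((e(x := a)) i))" for a
    by auto
  then have "forces \<phi> ((\<lambda>i. flip_name A (e i))(x := flip_name A a)) p \<longleftrightarrow> forces \<phi> (e(x := a)) (flip A p)" for a
    using FAll by presburger
  then show ?case by simp (metis flip_name_flip_name)
qed simp

section \<open>A countable family of names\<close>

instance soa_sym :: countable by countable_datatype

instance fm :: (countable) countable by countable_datatype

text \<open>Assignments from a countable family of names are in general uncountably many. A formula sees only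
finitely many variables, so assignments of finite support suffice, and of these there are countably
many.\<close>

definition fin_env :: "name set \<Rightarrow> (nat \<Rightarrow> name) set" where
  "fin_env N = {e. range e \<subseteq> N \<and> finite {i. e i \<noteq> Nat_name 0}}"

lemma fin_env_upd: "e \<in> fin_env N \<Longrightarrow> a \<in> N \<Longrightarrow> e(x := a) \<in> fin_env N"
proof -
  assume e: "e \<in> fin_env N" and "a \<in> N"
  have "{i. (e(x := a)) i \<noteq> Nat_name 0} \<subseteq> insert x {i. e i \<noteq> Nat_name 0}" by auto
  then have "finite {i. (e(x := a)) i \<noteq> Nat_name 0}"
    using e by (elim finite_subset) (simp add: fin_env_def)
  then show ?thesis using e \<open>a \<in> N\<close> by (auto simp: fin_env_def)
qed

lemma countable_fin_env: "countable N \<Longrightarrow> countable (fin_env N)"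
proof -
  assume "countable N"
  define env where "env = (\<lambda>as i. if i < length as then as ! i else Nat_name 0)"
  have "fin_env N \<subseteq> env ` lists N"
  proof
    fix e assume e: "e \<in> fin_env N"
    then obtain k where "\<forall>i \<in> {i. e i \<noteq> Nat_name 0}. i < k"
      by (metis (no_types, lifting) fin_env_def finite_nat_bounded lessThan_iff mem_Collect_eq subset_eq)
    then have "e = env (map e [0..<k])" by (force simp: env_def)
    moreover have "map e [0..<k] \<in> lists N" using e by (fastforce simp: fin_env_def)
    ultimately show "e \<in> env ` lists N" by blast
  qed
  then show ?thesis using \<open>countable N\<close> by (meson countable_image countable_lists countable_subset)
qed

text \<open>Closing under operations that take an assignment as their argument: a finitely supported assignment
uses finitely many names, hence lives in one of the countable stages.\<close>

lemma countable_closed_names: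
  fixes \<F> :: "((nat \<Rightarrow> name) \<Rightarrow> name) set"
  assumes "countable \<F>"
  obtains N where "countable N" "Nat_name 0 \<in> N" "\<And>f e. f \<in> \<F> \<Longrightarrow> e \<in> fin_env N \<Longrightarrow> f e \<in> N"
proof -
  define stage where
    "stage = rec_nat {Nat_name 0} (\<lambda>k M. M \<union> (\<lambda>(f, e). f e) ` (\<F> \<times> fin_env M))"
  have Suc: "stage (Suc k) = stage k \<union> (\<lambda>(f, e). f e) ` (\<F> \<times> fin_env (stage k))" for k
    by (simp add: stage_def)
  have zero: "stage 0 = {Nat_name 0}" by (simp add: stage_def)
  have cnt: "countable (stage k)" for k
    by (induction k) (use assms in \<open>auto simp: zero Suc intro!: countable_fin_env\<close>)
  have mono: "stage k \<subseteq> stage l" if "k \<le> l" for k l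
    using that by (induction rule: dec_induct) (auto simp: Suc)
  show ?thesis
  proof
    show "countable (\<Union>k. stage k)" using cnt by auto
    show "Nat_name 0 \<in> (\<Union>k. stage k)" using zero by blast
    fix f e assume f: "f \<in> \<F>" and e: "e \<in> fin_env (\<Union>k. stage k)"
    have "range e \<subseteq> e ` {i. e i \<noteq> Nat_name 0} \<union> {Nat_name 0}" by auto
    then have "finite (range e)" using e by (auto simp: fin_env_def intro: finite_subset)
    moreover have "\<exists>k. F \<subseteq> stage k" if "finite F" "F \<subseteq> (\<Union>k. stage k)" for F
      using that
    proof induction
      case (insert a F)
      then obtain k l where "F \<subseteq> stage k" "a \<in> stage l" by auto
      then show ?case using mono[of k "max k l"] mono[of l "max k l"] by (intro exI[of _ "max k l"]) auto
    qed simp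
    ultimately obtain k where "range e \<subseteq> stage k" using e unfolding fin_env_def by blast
    then have "e \<in> fin_env (stage k)" using e by (simp add: fin_env_def)
    then have "f e \<in> stage (Suc k)" using f unfolding Suc by force
    then show "f e \<in> (\<Union>k. stage k)" by blast
  qed
qed

definition cohen_name :: name where
  "cohen_name = Set_name (\<lambda>n. {p. n < length p \<and> p ! n})"

text \<open>An arbitrary name if \<open>q\<close> forces \<open>\<phi>\<close> of none.\<close>

definition skolem_name :: "soa_sym fm \<Rightarrow> nat \<Rightarrow> cond \<Rightarrow> (nat \<Rightarrow> name) \<Rightarrow> name" where
  "skolem_name \<phi> x q e = (SOME a. forces \<phi> (e(x := a)) q)"

definition compr_name :: "soa_sym fm \<Rightarrow> nat \<Rightarrow> (nat \<Rightarrow> name) \<Rightarrow> name" where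
  "compr_name \<phi> n e = Set_name (\<lambda>m. {p. forces \<phi> (e(n := Nat_name m)) p})"

definition witnessed :: "soa_sym fm \<Rightarrow> nat \<Rightarrow> (nat \<Rightarrow> name) \<Rightarrow> cond set" where
  "witnessed \<phi> Y e = {q. \<exists>a. forces \<phi> (e(Y := a)) q}"

text \<open>A name for a set whose \<open>m\<close>-th row realises \<open>\<phi>\<close>. Conditions form a tree, so each condition \<open>r\<close> has
at most one shortest initial segment \<open>take j r\<close> that forces \<open>\<phi>\<close> of some name. The \<open>m\<close>-th row is
glued from the Skolem names chosen at these pairwise incompatible segments.\<close>

definition choice_name :: "soa_sym fm \<Rightarrow> nat \<Rightarrow> nat \<Rightarrow> (nat \<Rightarrow> name) \<Rightarrow> name" where
  "choice_name \<phi> n Y e = Set_name (\<lambda>k. {r. \<exists>i m j y. k = pair_code i m \<and> j \<le> length r \<and>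
     take j r \<in> witnessed \<phi> Y (e(n := Nat_name m)) \<and>
     (\<forall>l < j. take l r \<notin> witnessed \<phi> Y (e(n := Nat_name m))) \<and>
     skolem_name \<phi> Y (take j r) (e(n := Nat_name m)) = Set_name y \<and> r \<in> dense_closure (y i)})"

definition name_operations :: "((nat \<Rightarrow> name) \<Rightarrow> name) set" where
  "name_operations = range (\<lambda>n e. Nat_name n) \<union>
     (\<lambda>A e. flip_name A cohen_name) ` insert UNIV (range lessThan) \<union>
     range (\<lambda>(\<phi>, x, q). skolem_name \<phi> x q) \<union>
     range (\<lambda>(\<phi>, n). compr_name \<phi> n) \<union>
     range (\<lambda>(\<phi>, n, Y). choice_name \<phi> n Y)"

lemma countable_name_operations: "countable name_operations"
  unfolding name_operations_def by (intro countable_Un countable_image countable_insert countableI_type)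

text \<open>The sets that the real has to decide: the conditions forcing a formula, those forcing a
counterexample to a universal formula, and those forcing a difference between two set names.\<close>

definition decision_sets :: "name set \<Rightarrow> cond set set" where
  "decision_sets N =
     (\<lambda>(\<phi>, e). {q. forces \<phi> e q}) ` (UNIV \<times> fin_env N) \<union>
     (\<lambda>(\<phi>, x, e). {q. \<exists>a \<in> N. forces (\<^bold>\<not> \<phi>) (e(x := a)) q}) ` (UNIV \<times> UNIV \<times> fin_env N) \<union>
     (\<lambda>(a, b). {q. \<exists>x y n. a = Set_name x \<and> b = Set_name y \<and> q \<in> dense_closure (x n) \<and>
        (\<forall>r. q \<preceq> r \<longrightarrow> r \<notin> dense_closure (y n))}) ` (N \<times> N)"

lemma countable_decision_sets: "countable N \<Longrightarrow> countable (decision_sets N)"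
  unfolding decision_sets_def
  by (intro countable_Un countable_image countable_SIGMA countableI_type countable_fin_env)

primrec evaluate :: "(nat \<Rightarrow> bool) \<Rightarrow> name \<Rightarrow> nat + nat set" where
  "evaluate c (Nat_name n) = Inl n"
| "evaluate c (Set_name x) = Inr {n. \<exists>k. stem c k \<in> dense_closure (x n)}"

lemma evaluate_cohen_name: "evaluate c (flip_name A cohen_name) = Inr {n. c n \<noteq> (n \<in> A)}"
proof -
  let ?D = "\<lambda>n. {p. n < length p \<and> p ! n \<noteq> (n \<in> A)}"
  have "(\<exists>k. stem c k \<in> dense_closure (?D n)) \<longleftrightarrow> c n \<noteq> (n \<in> A)" for n
  proof
    assume "\<exists>k. stem c k \<in> dense_closure (?D n)"
    then obtain k where "stem c k \<in> dense_closure (?D n)" by blast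
    then have "stem c (max k (Suc n)) \<in> dense_closure (?D n)" by (rule dense_closure_upward) simp
    then obtain r where "stem c (max k (Suc n)) \<preceq> r" "r \<in> ?D n"
      unfolding dense_closure_def using extends_refl by blast
    then show "c n \<noteq> (n \<in> A)" by (auto simp: extends_def)
  next
    assume c: "c n \<noteq> (n \<in> A)"
    have "stem c (Suc n) \<in> dense_closure (?D n)"
      by (rule dense_closure_superset) (use c in \<open>auto simp: extends_def\<close>)
    then show "\<exists>k. stem c k \<in> dense_closure (?D n)" ..
  qed
  moreover have "{p. flip A p \<in> {p. n < length p \<and> p ! n}} = ?D n" for n by auto
  ultimately show ?thesis by (simp add: cohen_name_def)
qed

section \<open>The generic model of second-order arithmetic\<close>

text \<open>\<open>Nat_name 0\<close> is the default value of finitely supported assignments, which take their values in \<open>N\<close>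
only if it belongs to \<open>N\<close>.\<close>

locale cohen_extension =
  fixes N :: "name set" and c :: "nat \<Rightarrow> bool"
  assumes closed: "f \<in> name_operations \<Longrightarrow> e \<in> fin_env N \<Longrightarrow> f e \<in> N"
    and nonempty: "Nat_name 0 \<in> N"
    and generic: "D \<in> decision_sets N \<Longrightarrow> \<exists>k. stem c k \<in> D \<or> (\<forall>q. stem c k \<preceq> q \<longrightarrow> q \<notin> D)"
begin

definition reals :: "nat set set" where
  "reals = {X. Inr X \<in> evaluate c ` N}"

abbreviation generic_model :: "(soa_sym, nat + nat set) struct" where
  "generic_model \<equiv> omega_struct reals"

definition restrict_env :: "soa_sym fm \<Rightarrow> (nat \<Rightarrow> name) \<Rightarrow> nat \<Rightarrow> name" where
  "restrict_env \<phi> e = (\<lambda>i. if i \<in> fv \<phi> then e i else Nat_name 0)"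

lemma restrict_env: "range e \<subseteq> N \<Longrightarrow> restrict_env \<phi> e \<in> fin_env N"
  using nonempty finite_fv[of \<phi>] by (auto simp: restrict_env_def fin_env_def)

lemma forces_restrict_env: "forces \<phi> (restrict_env \<phi> e) = forces \<phi> e"
  by (rule forces_cong) (simp add: restrict_env_def)

lemma const_env: "(\<lambda>i. Nat_name 0) \<in> fin_env N"
  using nonempty by (auto simp: fin_env_def)

lemma Nat_name_in_N: "Nat_name n \<in> N"
  using closed[OF _ const_env, of "\<lambda>e. Nat_name n"] by (auto simp: name_operations_def)

lemma flip_cohen_name_in_N: "A = UNIV \<or> A = {..<m} \<Longrightarrow> flip_name A cohen_name \<in> N"
  using closed[OF _ const_env, of "\<lambda>e. flip_name A cohen_name"] by (auto simp: name_operations_def)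

lemma skolem_name_in_N: "e \<in> fin_env N \<Longrightarrow> skolem_name \<phi> x q e \<in> N"
  by (rule closed[of "skolem_name \<phi> x q" e], unfold name_operations_def, rule UnI1, rule UnI1, rule UnI2, rule image_eqI[of _ _ "(\<phi>, x, q)"]) simp_all

lemma compr_name_in_N: "e \<in> fin_env N \<Longrightarrow> compr_name \<phi> n e \<in> N"
  by (rule closed[of "compr_name \<phi> n" e], unfold name_operations_def, rule UnI1, rule UnI2, rule image_eqI[of _ _ "(\<phi>, n)"]) simp_all

lemma choice_name_in_N: "e \<in> fin_env N \<Longrightarrow> choice_name \<phi> n Y e \<in> N"
  by (rule closed[of "choice_name \<phi> n Y" e], unfold name_operations_def, rule UnI2, rule image_eqI[of _ _ "(\<phi>, n, Y)"]) simp_all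

lemma Dom_generic_model: "UNIV <+> reals = evaluate c ` N"
proof -
  have "Inl n \<in> evaluate c ` N" for n
    using Nat_name_in_N[of n] by (metis evaluate.simps(1) image_eqI)
  then have "z \<in> UNIV <+> reals \<longleftrightarrow> z \<in> evaluate c ` N" for z
    by (cases z) (simp_all add: reals_def)
  then show ?thesis by blast
qed

lemma generic_decides:
  assumes "range e \<subseteq> N"
  shows "\<exists>k. forces \<phi> e (stem c k) \<or> forces (\<^bold>\<not> \<phi>) e (stem c k)"
proof -
  have "{q. forces \<phi> (restrict_env \<phi> e) q} \<in> decision_sets N"
    using restrict_env[OF assms] by (auto simp: decision_sets_def)
  from generic[OF this] show ?thesis by (auto simp: forces_restrict_env)
qed

lemma generic_consistent: "forces \<phi> e (stem c k) \<Longrightarrow> \<not> forces (\<^bold>\<not> \<phi>) e (stem c l)"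
  using forces_upward[of \<phi> e "stem c k" "stem c (max k l)"] by (auto intro!: exI[of _ "stem c (max k l)"])

text \<open>Negation is decided by genericity. For a universal formula, an initial segment of \<open>c\<close> beyond which
no counterexample is forced must force the formula: otherwise some extension would force a
counterexample from among all names, and by closure under Skolem names one in \<open>N\<close>.\<close>

lemma truth:
  assumes "range e \<subseteq> N"
  shows "sat generic_model (\<lambda>i. evaluate c (e i)) \<phi> \<longleftrightarrow> (\<exists>k. forces \<phi> e (stem c k))"
  using assms
proof (induction \<phi> arbitrary: e)
  case (Eq v w)
  have N: "e v \<in> N" "e w \<in> N" using Eq by auto
  show ?case
  proof (cases "\<exists>x y. e v = Set_name x \<and> e w = Set_name y")
    case True
    then obtain x y where xy: "e v = Set_name x" "e w = Set_name y" by blast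
    let ?val = "\<lambda>x :: nat \<Rightarrow> cond set. {n. \<exists>k. stem c k \<in> dense_closure (x n)}"
    \<comment> \<open>The conditions forcing some \<open>n\<close> into \<open>x\<close> and out of \<open>y\<close>; \<open>c\<close> avoids them if the values agree.\<close>
    let ?D = "\<lambda>x y. {q. \<exists>n. q \<in> dense_closure (x n) \<and> (\<forall>r. q \<preceq> r \<longrightarrow> r \<notin> dense_closure (y n))}"
    have gen: "\<exists>k. \<forall>q. stem c k \<preceq> q \<longrightarrow> q \<notin> ?D x y"
      if "Set_name x \<in> N" "Set_name y \<in> N" and val: "?val x = ?val y" for x y :: "nat \<Rightarrow> cond set"
    proof -
      have "?D x y \<in> decision_sets N"
        unfolding decision_sets_def using that by (intro UnI2 image_eqI[of _ _ "(Set_name x, Set_name y)"]) auto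
      then obtain k where k: "stem c k \<in> ?D x y \<or> (\<forall>q. stem c k \<preceq> q \<longrightarrow> q \<notin> ?D x y)"
        using generic by blast
      have "stem c k \<notin> ?D x y"
      proof
        assume "stem c k \<in> ?D x y"
        then obtain n where n: "n \<in> ?val x" "\<forall>r. stem c k \<preceq> r \<longrightarrow> r \<notin> dense_closure (y n)" by blast
        then obtain l where "stem c l \<in> dense_closure (y n)" using val by blast
        then have "stem c (max k l) \<in> dense_closure (y n)" by (rule dense_closure_upward) simp
        then show False using n(2) by simp
      qed
      then show ?thesis using k by blast
    qed
    have sub: "dense_closure (x n) \<inter> {q. p \<preceq> q} \<subseteq> dense_closure (y n)"
      if "\<forall>q. p \<preceq> q \<longrightarrow> q \<notin> ?D x y" for p n and x y :: "nat \<Rightarrow> cond set"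
    proof
      fix q assume q: "q \<in> dense_closure (x n) \<inter> {q. p \<preceq> q}"
      have "\<exists>r. q' \<preceq> r \<and> r \<in> dense_closure (y n)" if "q \<preceq> q'" for q'
        using \<open>\<forall>q. p \<preceq> q \<longrightarrow> q \<notin> ?D x y\<close> that q dense_closure_upward extends_trans by blast
      then have "q \<in> dense_closure (dense_closure (y n))" unfolding dense_closure_def[of "dense_closure _"] by blast
      then show "q \<in> dense_closure (y n)" by simp
    qed
    have "?val x = ?val y \<longleftrightarrow> (\<exists>k. forces_eq (Set_name x) (Set_name y) (stem c k))"
    proof
      assume val: "?val x = ?val y"
      obtain k where "\<forall>q. stem c k \<preceq> q \<longrightarrow> q \<notin> ?D x y"
        using gen[OF _ _ val] N xy by auto
      moreover obtain l where "\<forall>q. stem c l \<preceq> q \<longrightarrow> q \<notin> ?D y x"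
        using gen[OF _ _ val[symmetric]] N xy by auto
      moreover have "stem c k \<preceq> stem c (max k l)" "stem c l \<preceq> stem c (max k l)" by simp_all
      ultimately have "\<forall>q. stem c (max k l) \<preceq> q \<longrightarrow> q \<notin> ?D x y" "\<forall>q. stem c (max k l) \<preceq> q \<longrightarrow> q \<notin> ?D y x"
        using extends_trans by blast+
      note sub[OF this(1)] sub[OF this(2)]
      then have "forces_eq (Set_name x) (Set_name y) (stem c (max k l))" unfolding forces_eq.simps by blast
      then show "\<exists>k. forces_eq (Set_name x) (Set_name y) (stem c k)" ..
    next
      assume "\<exists>k. forces_eq (Set_name x) (Set_name y) (stem c k)"
      then obtain k where k: "\<And>q n. stem c k \<preceq> q \<Longrightarrow> q \<in> dense_closure (x n) \<longleftrightarrow> q \<in> dense_closure (y n)"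
        by auto
      have up: "stem c (max k l) \<in> dense_closure (z n)" if "stem c l \<in> dense_closure (z n)" for l n and z :: "nat \<Rightarrow> cond set"
        using that by (rule dense_closure_upward) simp
      show "?val x = ?val y"
        using k[of "stem c (max k _)"] up[of _ x] up[of _ y] by (simp add: set_eq_iff) metis
    qed
    then show ?thesis by (simp add: xy)
  next
    case False
    then show ?thesis by (cases "e v"; cases "e w") auto
  qed
next
  case (Rel r xs)
  have N: "set (map e xs) \<subseteq> N" using Rel by auto
  have cong: "map (\<lambda>i. evaluate c (e i)) xs = map (evaluate c) (map e xs)" by simp
  have L: "map (evaluate c) (map e xs) \<in> lists (UNIV <+> reals)" using N unfolding Dom_generic_model by fastforce
  show ?case
  proof (cases "r = ElemS")
    case True
    have elem: "map (evaluate c) as \<in> arith_rel ElemS \<longleftrightarrow> (\<exists>k. forces_rel ElemS as (stem c k))" for as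
    proof
      assume "map (evaluate c) as \<in> arith_rel ElemS"
      then obtain n X where "map (evaluate c) as = [Inl n, Inr X]" "n \<in> X" by auto
      then obtain a b where ab: "as = [a, b]" "evaluate c a = Inl n" "evaluate c b = Inr X" "n \<in> X"
        by (auto simp: map_eq_Cons_conv)
      then show "\<exists>k. forces_rel ElemS as (stem c k)"
        by (cases a; cases b) (auto simp: forces_rel_def)
    qed (auto simp: forces_rel_def)
    show ?thesis using elem[of "map e xs"] True L unfolding sat.simps forces.simps cong
      by (simp add: omega_struct_def)
  next
    case False
    have same: "map (evaluate c) as \<in> arith_rel r \<longleftrightarrow> map sort_of as \<in> arith_rel r" for as
    proof -
      have "evaluate c a = Inl n \<longleftrightarrow> a = Nat_name n" "Inl n = evaluate c a \<longleftrightarrow> a = Nat_name n"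
        "sort_of a = Inl n \<longleftrightarrow> a = Nat_name n" "Inl n = sort_of a \<longleftrightarrow> a = Nat_name n"
        "(\<exists>X. evaluate c a = Inr X) \<longleftrightarrow> (\<exists>X. sort_of a = Inr X)" for a n
        by (cases a; auto)+
      note eqs = this
      show ?thesis
      proof (cases r)
        case SetS
        then show ?thesis using eqs(5) by (auto simp: map_eq_Cons_conv) metis+
      qed (use False in \<open>auto simp: map_eq_Cons_conv eqs\<close>)
    qed
    show ?thesis using same[of "map e xs"] False L unfolding sat.simps forces.simps cong
      by (simp add: omega_struct_def forces_rel_def)
  qed
next
  case (Neg \<phi>)
  then have "sat generic_model (\<lambda>i. evaluate c (e i)) (\<^bold>\<not> \<phi>) \<longleftrightarrow> \<not> (\<exists>k. forces \<phi> e (stem c k))" by simp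
  then show ?case using generic_decides[OF Neg.prems] generic_consistent by blast
next
  case (Conj \<phi> \<psi>)
  have "\<exists>m. forces (\<phi> \<^bold>\<and> \<psi>) e (stem c m)" if "forces \<phi> e (stem c k)" "forces \<psi> e (stem c l)" for k l
    using that forces_upward[of _ e _ "stem c (max k l)"] by (intro exI[of _ "max k l"]) simp
  then show ?case using Conj by auto
next
  case (FAll x \<phi>)
  have upd: "(\<lambda>i. evaluate c (e i))(x := evaluate c a) = (\<lambda>i. evaluate c ((e(x := a)) i))" for a by auto
  have "sat generic_model ((\<lambda>i. evaluate c (e i))(x := evaluate c a)) \<phi> \<longleftrightarrow> (\<exists>k. forces \<phi> (e(x := a)) (stem c k))"
    if "a \<in> N" for a
    unfolding upd by (rule FAll.IH) (use FAll.prems that in auto)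
  then have "sat generic_model (\<lambda>i. evaluate c (e i)) (\<^bold>\<forall>x. \<phi>) \<longleftrightarrow> (\<forall>a \<in> N. \<exists>k. forces \<phi> (e(x := a)) (stem c k))"
    unfolding sat.simps Dom_omega_struct Dom_generic_model by simp
  also have "\<dots> \<longleftrightarrow> (\<exists>k. forces (\<^bold>\<forall>x. \<phi>) e (stem c k))"
  proof
    assume all: "\<forall>a \<in> N. \<exists>k. forces \<phi> (e(x := a)) (stem c k)"
    define e' where "e' = restrict_env \<phi> e"
    have e': "e' \<in> fin_env N" unfolding e'_def by (rule restrict_env) (rule FAll.prems)
    have cong: "forces \<phi> (e'(x := a)) = forces \<phi> (e(x := a))" for a
      by (rule forces_cong) (simp add: e'_def restrict_env_def)
    let ?D = "{q. \<exists>a \<in> N. forces (\<^bold>\<not> \<phi>) (e'(x := a)) q}"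
    have "?D \<in> decision_sets N"
      unfolding decision_sets_def using e' by (intro UnI1 UnI2 image_eqI[of _ _ "(\<phi>, x, e')"]) auto
    then obtain k where k: "stem c k \<in> ?D \<or> (\<forall>q. stem c k \<preceq> q \<longrightarrow> q \<notin> ?D)"
      using generic by blast
    moreover have "stem c k \<notin> ?D"
      using all generic_consistent[of \<phi> "e'(x := _)"] by (auto simp: cong simp del: forces.simps)
    ultimately have no_counterexample: "q \<notin> ?D" if "stem c k \<preceq> q" for q using that by blast
    have "forces \<phi> (e(x := a)) (stem c k)" for a
    proof (rule ccontr)
      assume "\<not> forces \<phi> (e(x := a)) (stem c k)"
      then obtain q where q: "stem c k \<preceq> q" "forces (\<^bold>\<not> \<phi>) (e'(x := a)) q"
        using not_forces cong by metis
      from q(2) have "forces (\<^bold>\<not> \<phi>) (e'(x := skolem_name (\<^bold>\<not> \<phi>) x q e')) q"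
        unfolding skolem_name_def by (rule someI)
      then show False using no_counterexample[OF q(1)] skolem_name_in_N[OF e'] by blast
    qed
    then show "\<exists>k. forces (\<^bold>\<forall>x. \<phi>) e (stem c k)" by auto
  qed auto
  finally show ?case .
qed

lemma env_names:
  assumes "range d \<subseteq> UNIV <+> reals"
  obtains e where "range e \<subseteq> N" "d = (\<lambda>i. evaluate c (e i))"
proof -
  have "\<exists>a \<in> N. d i = evaluate c a" for i using assms unfolding Dom_generic_model by auto
  then obtain e where "\<forall>i. e i \<in> N \<and> d i = evaluate c (e i)" by metis
  then show ?thesis using that[of e] by auto
qed

lemma evaluate_compr_name:
  assumes e: "e \<in> fin_env N"
  shows "evaluate c (compr_name \<phi> n e) =
    Inr {m. sat generic_model ((\<lambda>i. evaluate c (e i))(n := Inl m)) \<phi>}"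
proof -
  have "sat generic_model ((\<lambda>i. evaluate c (e i))(n := Inl m)) \<phi> \<longleftrightarrow>
      (\<exists>k. forces \<phi> (e(n := Nat_name m)) (stem c k))" for m
  proof -
    have "range (e(n := Nat_name m)) \<subseteq> N" using e Nat_name_in_N by (auto simp: fin_env_def)
    moreover have "(\<lambda>i. evaluate c (e i))(n := Inl m) = (\<lambda>i. evaluate c ((e(n := Nat_name m)) i))" by auto
    ultimately show ?thesis using truth by metis
  qed
  then show ?thesis by (simp add: compr_name_def dense_closure_forces)
qed

text \<open>Let \<open>stem c k\<close> be the shortest initial segment of \<open>c\<close> that forces a witness for row \<open>m\<close>. For every
condition beyond it this segment is the one consulted by \<open>choice_name\<close>, so the row of the
choice name and the Skolem name chosen there have the same value.\<close>

lemma evaluate_choice_name: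
  assumes e: "e \<in> fin_env N" and nY: "n \<noteq> Y"
    and ex: "\<forall>m. \<exists>a \<in> N. sat generic_model (\<lambda>i. evaluate c ((e(n := Nat_name m, Y := a)) i)) (Set Y \<^bold>\<and> \<phi>)"
  obtains Z where "evaluate c (choice_name (Set Y \<^bold>\<and> \<phi>) n Y e) = Inr Z"
    "\<And>m. {i. pair_code i m \<in> Z} \<in> reals"
    "\<And>m. sat generic_model ((\<lambda>i. evaluate c (e i))(n := Inl m, Y := Inr {i. pair_code i m \<in> Z})) \<phi>"
proof -
  let ?\<psi> = "Set Y \<^bold>\<and> \<phi>"
  define Z where "Z = {k. \<exists>l. stem c l \<in> dense_closure {r. \<exists>i m j y. k = pair_code i m \<and> j \<le> length r \<and>
     take j r \<in> witnessed ?\<psi> Y (e(n := Nat_name m)) \<and>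
     (\<forall>l < j. take l r \<notin> witnessed ?\<psi> Y (e(n := Nat_name m))) \<and>
     skolem_name ?\<psi> Y (take j r) (e(n := Nat_name m)) = Set_name y \<and> r \<in> dense_closure (y i)}}"
  have Z: "evaluate c (choice_name ?\<psi> n Y e) = Inr Z" by (simp add: choice_name_def Z_def)
  have rows: "{i. pair_code i m \<in> Z} \<in> reals \<and>
      sat generic_model ((\<lambda>i. evaluate c (e i))(n := Inl m, Y := Inr {i. pair_code i m \<in> Z})) \<phi>" for m
  proof -
    define em where "em = e(n := Nat_name m)"
    have em: "em \<in> fin_env N" unfolding em_def by (rule fin_env_upd[OF e Nat_name_in_N])
    have rng: "range (em(Y := a)) \<subseteq> N" if "a \<in> N" for a using em that by (auto simp: fin_env_def)
    obtain a where "a \<in> N" "sat generic_model (\<lambda>i. evaluate c ((em(Y := a)) i)) ?\<psi>" using ex unfolding em_def by blast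
    then have "\<exists>k. forces ?\<psi> (em(Y := a)) (stem c k)" using truth[OF rng] by blast
    then have ex_k: "\<exists>k. stem c k \<in> witnessed ?\<psi> Y em" by (auto simp: witnessed_def simp del: forces.simps)
    define k where "k = (LEAST k. stem c k \<in> witnessed ?\<psi> Y em)"
    have k: "stem c k \<in> witnessed ?\<psi> Y em" unfolding k_def by (rule LeastI_ex[OF ex_k])
    have k_min: "stem c l \<notin> witnessed ?\<psi> Y em" if "l < k" for l
      using that unfolding k_def by (rule not_less_Least)
    define b where "b = skolem_name ?\<psi> Y (stem c k) em"
    have b_N: "b \<in> N" unfolding b_def by (rule skolem_name_in_N[OF em])
    have b: "forces ?\<psi> (em(Y := b)) (stem c k)"
      using k unfolding b_def skolem_name_def witnessed_def by (auto intro: someI simp del: forces.simps)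
    then have sort: "\<exists>y. b = Set_name y" by (cases b) (auto simp: forces_rel_def)
    then obtain y where y: "b = Set_name y" by blast
    have "r \<in> {r. \<exists>j y. j \<le> length r \<and> take j r \<in> witnessed ?\<psi> Y em \<and>
        (\<forall>l < j. take l r \<notin> witnessed ?\<psi> Y em) \<and>
        skolem_name ?\<psi> Y (take j r) em = Set_name y \<and> r \<in> dense_closure (y i)} \<longleftrightarrow> r \<in> dense_closure (y i)"
      (is "r \<in> ?R i \<longleftrightarrow> _") if r: "stem c k \<preceq> r" for r i
    proof -
      have t: "take l r = stem c l" if "l \<le> k" for l
        using take_extends[OF r, of l] that by (simp add: take_stem)
      have "j = k" if "take j r \<in> witnessed ?\<psi> Y em" "\<forall>l < j. take l r \<notin> witnessed ?\<psi> Y em" for j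
        using that t k k_min by (metis linorder_neqE_nat less_imp_le_nat order_refl)
      moreover have "k \<le> length r" using r by (simp add: extends_def)
      moreover have "take k r = stem c k" "\<forall>l < k. take l r \<notin> witnessed ?\<psi> Y em"
        using t k_min by simp_all
      moreover have "skolem_name ?\<psi> Y (stem c k) em = Set_name y" using y b_def by simp
      ultimately show ?thesis
        unfolding mem_Collect_eq using k by (metis name.inject(2))
    qed
    then have "stem c l \<in> dense_closure (?R i) \<longleftrightarrow> stem c l \<in> dense_closure (dense_closure (y i))" if "k \<le> l" for l i
      using that extends_trans stem_extends_stem
      unfolding dense_closure_def[of "?R i"] dense_closure_def[of "dense_closure (y i)"] mem_Collect_eq[of "stem c l"]
      by meson
    then have eq: "stem c (max k l) \<in> dense_closure (?R i) \<longleftrightarrow> stem c (max k l) \<in> dense_closure (y i)" for l i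
      by simp
    have "(\<exists>l. stem c l \<in> dense_closure D) \<longleftrightarrow> (\<exists>l. stem c (max k l) \<in> dense_closure D)" for D
      using dense_closure_upward stem_extends_stem by (meson max.cobounded2)
    then have "pair_code i m \<in> Z \<longleftrightarrow> (\<exists>l. stem c l \<in> dense_closure (y i))" for i
      using eq by (simp add: Z_def pair_code_eq_iff flip: em_def)
    then have val: "evaluate c b = Inr {i. pair_code i m \<in> Z}" by (simp add: y)
    have "sat generic_model (\<lambda>i. evaluate c ((em(Y := b)) i)) ?\<psi>" using truth[OF rng[OF b_N]] b by blast
    moreover have "(\<lambda>i. evaluate c ((em(Y := b)) i)) =
        (\<lambda>i. evaluate c (e i))(n := Inl m, Y := Inr {i. pair_code i m \<in> Z})"
      using val by (auto simp: em_def)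
    ultimately have "sat generic_model ((\<lambda>i. evaluate c (e i))(n := Inl m, Y := Inr {i. pair_code i m \<in> Z})) \<phi>" by simp
    moreover have "{i. pair_code i m \<in> Z} \<in> reals"
      unfolding reals_def using val b_N by (metis (mono_tags) image_eqI mem_Collect_eq)
    ultimately show ?thesis by blast
  qed
  show ?thesis by (rule that[of Z]) (use Z rows in auto)
qed

lemma generic_model_models_SOA: "generic_model \<in> models SOA"
proof (rule omega_struct_models_SOA)
  fix \<phi> n and d :: "nat \<Rightarrow> nat + nat set" assume d: "range d \<subseteq> UNIV <+> reals"
  obtain e where e: "range e \<subseteq> N" "d = (\<lambda>i. evaluate c (e i))" using env_names[OF d] .
  define e' where "e' = restrict_env \<phi> e"
  have e': "e' \<in> fin_env N" unfolding e'_def by (rule restrict_env[OF e(1)])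
  have "sat generic_model ((\<lambda>i. evaluate c (e' i))(n := Inl m)) \<phi> \<longleftrightarrow> sat generic_model (d(n := Inl m)) \<phi>" for m
    by (rule sat_cong) (auto simp: e e'_def restrict_env_def)
  then have "Inr {m. sat generic_model (d(n := Inl m)) \<phi>} = evaluate c (compr_name \<phi> n e')"
    using evaluate_compr_name[OF e'] by simp
  then show "{m. sat generic_model (d(n := Inl m)) \<phi>} \<in> reals"
    unfolding reals_def using compr_name_in_N[OF e'] by blast
next
  fix \<phi> n Y and d :: "nat \<Rightarrow> nat + nat set" assume d: "range d \<subseteq> UNIV <+> reals" and nY: "n \<noteq> (Y :: nat)"
    and ex: "\<forall>m. \<exists>X \<in> reals. sat generic_model (d(n := Inl m, Y := Inr X)) \<phi>"
  obtain e where e: "range e \<subseteq> N" "d = (\<lambda>i. evaluate c (e i))" using env_names[OF d] .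
  define e' where "e' = restrict_env \<phi> e"
  have e': "e' \<in> fin_env N" unfolding e'_def by (rule restrict_env[OF e(1)])
  have cong: "sat generic_model ((\<lambda>i. evaluate c (e' i))(n := u, Y := v)) \<phi> \<longleftrightarrow> sat generic_model (d(n := u, Y := v)) \<phi>" for u v
    by (rule sat_cong) (auto simp: e e'_def restrict_env_def)
  have "\<exists>a \<in> N. sat generic_model (\<lambda>i. evaluate c ((e'(n := Nat_name m, Y := a)) i)) (Set Y \<^bold>\<and> \<phi>)" for m
  proof -
    obtain X where X: "X \<in> reals" "sat generic_model (d(n := Inl m, Y := Inr X)) \<phi>" using ex by blast
    then obtain a where a: "a \<in> N" "evaluate c a = Inr X" unfolding reals_def by force
    have "(\<lambda>i. evaluate c ((e'(n := Nat_name m, Y := a)) i)) = (\<lambda>i. evaluate c (e' i))(n := Inl m, Y := Inr X)"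
      using a by auto
    then show ?thesis using a X cong by (intro bexI[of _ a]) auto
  qed
  then obtain Z where Z: "evaluate c (choice_name (Set Y \<^bold>\<and> \<phi>) n Y e') = Inr Z"
    "\<And>m. {i. pair_code i m \<in> Z} \<in> reals"
    "\<And>m. sat generic_model ((\<lambda>i. evaluate c (e' i))(n := Inl m, Y := Inr {i. pair_code i m \<in> Z})) \<phi>"
    using evaluate_choice_name[OF e' nY] by blast
  have "Z \<in> reals" unfolding reals_def using Z(1) choice_name_in_N[OF e'] by (metis (mono_tags) image_eqI mem_Collect_eq)
  then show "\<exists>Z \<in> reals. \<forall>m. {i. pair_code i m \<in> Z} \<in> reals \<and>
      sat generic_model (d(n := Inl m, Y := Inr {i. pair_code i m \<in> Z})) \<phi>"
    using Z cong by blast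
qed

lemma flipped_real: "A = UNIV \<or> A = {..<m} \<Longrightarrow> {n. c n \<noteq> (n \<in> A)} \<in> reals"
  unfolding reals_def using evaluate_cohen_name[of c A] flip_cohen_name_in_N[of A m]
  by (metis (mono_tags, lifting) image_eqI mem_Collect_eq)

text \<open>If \<open>stem c k\<close> forces \<open>\<phi>\<close> of the complement, then \<open>flip UNIV (stem c k)\<close> forces \<open>\<phi>\<close> of the Cohen real
itself. This condition is also \<open>flip {..<k} (stem c k)\<close>, and so flipping back by \<open>{..<k}\<close> shows that
\<open>stem c k\<close> forces \<open>\<phi>\<close> of the real with only its first \<open>k\<close> bits flipped. The other parameters
are numbers, which no flip moves.\<close>

lemma homogeneity:
  fixes d :: "nat \<Rightarrow> nat"
  assumes "sat generic_model ((\<lambda>i. Inl (d i))(x := Inr {n. \<not> c n})) \<phi>"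
  shows "\<exists>m. sat generic_model ((\<lambda>i. Inl (d i))(x := Inr {n. c n \<noteq> (n < m)})) \<phi>"
proof -
  define e where "e = (\<lambda>i. Nat_name (d i))(x := cohen_name)"
  have flip: "sat generic_model ((\<lambda>i. Inl (d i))(x := Inr {n. c n \<noteq> (n \<in> A)})) \<phi> \<longleftrightarrow>
      (\<exists>k. forces \<phi> e (flip A (stem c k)))" if A: "A = UNIV \<or> A = {..<m}" for A m
  proof -
    have "range (\<lambda>i. flip_name A (e i)) \<subseteq> N"
      using flip_cohen_name_in_N[OF A] Nat_name_in_N by (auto simp: e_def)
    moreover have "(\<lambda>i. evaluate c (flip_name A (e i))) = (\<lambda>i. Inl (d i))(x := Inr {n. c n \<noteq> (n \<in> A)})"
      using evaluate_cohen_name[of c A] by (auto simp: e_def)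
    ultimately show ?thesis using truth[of "\<lambda>i. flip_name A (e i)" \<phi>] by (simp add: forces_flip)
  qed
  obtain k where "forces \<phi> e (flip UNIV (stem c k))" using assms flip[of UNIV] by auto
  moreover have "flip UNIV (stem c k) = flip {..<k} (stem c k)" by (auto intro!: nth_equalityI)
  ultimately show ?thesis using flip[of "{..<k}" k] by auto
qed

end

lemma cohen_extension_exists:
  obtains N c where "countable N" "cohen_extension N c"
proof -
  obtain N where N: "countable N" "Nat_name 0 \<in> N" "\<And>f e. f \<in> name_operations \<Longrightarrow> e \<in> fin_env N \<Longrightarrow> f e \<in> N"
    using countable_closed_names[OF countable_name_operations] by blast
  obtain c where "\<And>D. D \<in> decision_sets N \<Longrightarrow> \<exists>k. stem c k \<in> D \<or> (\<forall>q. stem c k \<preceq> q \<longrightarrow> q \<notin> D)"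
    using generic_real_exists[OF countable_decision_sets[OF N(1)]] by blast
  then have "cohen_extension N c" using N by unfold_locales auto
  then show ?thesis using that N(1) by blast
qed

section \<open>Models of set theory\<close>

locale set_model =
  fixes A :: "(mem_sym, 'a) struct"
  assumes model: "A \<in> models ZFC_count"
begin

definition elts :: "'a \<Rightarrow> 'a set" where
  "elts a = {x \<in> Dom A. [x, a] \<in> Rels A Mem}"

lemma axiom_holds: "\<phi> \<in> ZFC_count_axioms \<Longrightarrow> range e \<subseteq> Dom A \<Longrightarrow> sat A e \<phi>"
  using model by (auto simp: models_def ZFC_count_def)

lemma elts_subset: "elts a \<subseteq> Dom A"
  by (auto simp: elts_def)

lemma elts_inject:
  assumes "x \<in> Dom A" "y \<in> Dom A" "elts x = elts y"
  shows "x = y"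
proof -
  have "sat A ((\<lambda>_. x)(1 := y)) ((\<^bold>\<forall>2. 2 \<^bold>\<in> 0 \<^bold>\<longleftrightarrow> 2 \<^bold>\<in> 1) \<^bold>\<longrightarrow> 0 \<^bold>= 1)"
    by (rule axiom_holds, rule ZFC_count_axioms.extensionality) (use assms in auto)
  then show ?thesis using assms(3) by (auto simp: elts_def set_eq_iff)
qed

lemma upair:
  assumes "x \<in> Dom A" "y \<in> Dom A"
  shows "\<exists>p \<in> Dom A. elts p = {x, y}"
proof -
  have "sat A ((\<lambda>_. x)(1 := y)) (\<^bold>\<exists>2. is_upair 0 1 2)"
    by (rule axiom_holds, rule ZFC_count_axioms.pairing) (use assms in auto)
  then obtain p where "p \<in> Dom A" "\<forall>z \<in> Dom A. [z, p] \<in> Rels A Mem \<longleftrightarrow> z = x \<or> z = y"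
    by (auto simp: is_upair_def Let_def fresh_def)
  then show ?thesis using assms by (intro bexI[of _ p]) (auto simp: elts_def)
qed

lemma union:
  assumes "x \<in> Dom A"
  shows "\<exists>u \<in> Dom A. elts u = \<Union> (elts ` elts x)"
proof -
  have "sat A (\<lambda>_. x) (\<^bold>\<exists>3. \<^bold>\<forall>2. 2 \<^bold>\<in> 3 \<^bold>\<longleftrightarrow> (\<^bold>\<exists>1. 1 \<^bold>\<in> 0 \<^bold>\<and> 2 \<^bold>\<in> 1))"
    by (rule axiom_holds, rule ZFC_count_axioms.union) (use assms in auto)
  then obtain u where "u \<in> Dom A"
    "\<forall>z \<in> Dom A. [z, u] \<in> Rels A Mem \<longleftrightarrow> (\<exists>y \<in> Dom A. [y, x] \<in> Rels A Mem \<and> [z, y] \<in> Rels A Mem)"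
    by auto
  then show ?thesis by (intro bexI[of _ u]) (auto simp: elts_def)
qed

lemma separation:
  assumes "wf_fm mem_arity \<phi>" "range e \<subseteq> Dom A" "a \<in> Dom A"
  shows "\<exists>b \<in> Dom A. elts b = {x \<in> elts a. sat A (e(i := x)) \<phi>}"
proof -
  obtain k where k: "k \<notin> insert i (fv \<phi>)"
    using ex_new_if_finite[OF infinite_UNIV_nat, of "insert i (fv \<phi>)"] finite_fv by auto
  obtain l where l: "l \<notin> insert k (insert i (fv \<phi>))"
    using ex_new_if_finite[OF infinite_UNIV_nat, of "insert k (insert i (fv \<phi>))"] finite_fv by auto
  have "sat A (e(k := a)) (\<^bold>\<exists>l. \<^bold>\<forall>i. i \<^bold>\<in> l \<^bold>\<longleftrightarrow> i \<^bold>\<in> k \<^bold>\<and> \<phi>)"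
    by (rule axiom_holds, rule ZFC_count_axioms.separation) (use assms k l in auto)
  moreover have "sat A (e(k := a, l := b, i := x)) \<phi> \<longleftrightarrow> sat A (e(i := x)) \<phi>" for b x
    by (rule sat_cong) (use k l in auto)
  ultimately obtain b where "b \<in> Dom A"
    "\<forall>x \<in> Dom A. [x, b] \<in> Rels A Mem \<longleftrightarrow> [x, a] \<in> Rels A Mem \<and> sat A (e(i := x)) \<phi>"
    using k l by auto
  then show ?thesis by (intro bexI[of _ b]) (auto simp: elts_def)
qed

lemma collection:
  assumes "wf_fm mem_arity \<phi>" "range e \<subseteq> Dom A" "a \<in> Dom A" "i \<noteq> j"
    and ex: "\<forall>x \<in> elts a. \<exists>y \<in> Dom A. sat A (e(i := x, j := y)) \<phi>"
  shows "\<exists>b \<in> Dom A. \<forall>x \<in> elts a. \<exists>y \<in> elts b. sat A (e(i := x, j := y)) \<phi>"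
proof -
  obtain k where k: "k \<notin> {i, j} \<union> fv \<phi>"
    using ex_new_if_finite[OF infinite_UNIV_nat, of "{i, j} \<union> fv \<phi>"] finite_fv by auto
  obtain l where l: "l \<notin> {i, j, k} \<union> fv \<phi>"
    using ex_new_if_finite[OF infinite_UNIV_nat, of "{i, j, k} \<union> fv \<phi>"] finite_fv by auto
  have ax: "sat A (e(k := a)) ((\<^bold>\<forall>i. i \<^bold>\<in> k \<^bold>\<longrightarrow> (\<^bold>\<exists>j. \<phi>)) \<^bold>\<longrightarrow>
      (\<^bold>\<exists>l. \<^bold>\<forall>i. i \<^bold>\<in> k \<^bold>\<longrightarrow> (\<^bold>\<exists>j. j \<^bold>\<in> l \<^bold>\<and> \<phi>)))"
    by (rule axiom_holds, rule ZFC_count_axioms.collection) (use assms k l in auto)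
  have drop: "sat A (e(k := a, i := x, j := y)) \<phi> \<longleftrightarrow> sat A (e(i := x, j := y)) \<phi>"
    "sat A (e(k := a, l := b, i := x, j := y)) \<phi> \<longleftrightarrow> sat A (e(i := x, j := y)) \<phi>" for b x y
    by (rule sat_cong; use k l in auto)+
  have "\<exists>b \<in> Dom A. \<forall>x \<in> Dom A. [x, a] \<in> Rels A Mem \<longrightarrow>
      (\<exists>y \<in> Dom A. [y, b] \<in> Rels A Mem \<and> sat A (e(i := x, j := y)) \<phi>)"
    using ax k l assms(4) ex by (simp add: drop elts_def) blast
  then show ?thesis unfolding elts_def by blast
qed

lemma finite_set_exists:
  assumes "finite F" "F \<subseteq> Dom A"
  shows "\<exists>a \<in> Dom A. elts a = F"
  using assms
proof induction
  case empty
  obtain a where "a \<in> Dom A" using model by (auto simp: models_def)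
  then show ?case using separation[of "\<^bold>\<not> 0 \<^bold>= 0" "\<lambda>_. a" a 0] by auto
next
  case (insert x F)
  then obtain a where a: "a \<in> Dom A" "elts a = F" by auto
  obtain b where b: "b \<in> Dom A" "elts b = {x, x}" using upair insert.prems by blast
  obtain p where p: "p \<in> Dom A" "elts p = {a, b}" using upair a b by blast
  show ?case using union[OF p(1)] p(2) a(2) b(2) by auto
qed

text \<open>An inductive set contains a von Neumann numeral of each finite size together with all of its
elements. Sizes grow because a numeral is not an element of itself, which is carried through the
induction together with transitivity.\<close>

lemma infinite_set_exists: "\<exists>w \<in> Dom A. infinite (elts w)"
proof -
  obtain a where "a \<in> Dom A" using model by (auto simp: models_def)
  then have "sat A (\<lambda>_. a) (\<^bold>\<exists>0. is_inductive 0)"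
    by (intro axiom_holds ZFC_count_axioms.infinity) auto
  then obtain w where w: "w \<in> Dom A" "sat A ((\<lambda>_. a)(0 := w)) (is_inductive 0)" by auto
  from w(2) have ind: "(\<exists>x \<in> Dom A. [x, w] \<in> Rels A Mem \<and> (\<forall>z \<in> Dom A. [z, x] \<notin> Rels A Mem)) \<and>
    (\<forall>x \<in> Dom A. [x, w] \<in> Rels A Mem \<longrightarrow> (\<exists>y \<in> Dom A. [y, w] \<in> Rels A Mem \<and>
      (\<forall>z \<in> Dom A. ([z, y] \<in> Rels A Mem \<or> z \<noteq> x \<and> [z, x] \<notin> Rels A Mem) \<and>
        ([z, y] \<in> Rels A Mem \<longrightarrow> z = x \<or> [z, x] \<in> Rels A Mem))))"
    by (simp add: is_inductive_def is_emptyset_def is_suc_def Let_def fresh_def conj_commute disj_commute)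
  obtain x0 where x0: "x0 \<in> elts w" "elts x0 = {}" using ind by (auto simp: elts_def)
  have step: "\<exists>y \<in> elts w. elts y = insert x (elts x)" if x: "x \<in> elts w" for x
  proof -
    obtain y where "y \<in> elts w" "\<forall>z \<in> Dom A. [z, y] \<in> Rels A Mem \<longleftrightarrow> [z, x] \<in> Rels A Mem \<or> z = x"
      using ind x unfolding elts_def by blast
    then show ?thesis using x by (intro bexI[of _ y]) (auto simp: elts_def)
  qed
  have "\<exists>v \<in> elts w. finite (elts v) \<and> card (elts v) = k \<and> elts v \<subseteq> elts w \<and> v \<notin> elts v \<and>
      (\<forall>u \<in> elts v. elts u \<subseteq> elts v)" for k
  proof (induction k)
    case 0
    show ?case using x0 by (intro bexI[of _ x0]) auto
  next
    case (Suc k)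
    then obtain v where v: "v \<in> elts w" "finite (elts v)" "card (elts v) = k" "elts v \<subseteq> elts w" "v \<notin> elts v"
      "\<forall>u \<in> elts v. elts u \<subseteq> elts v" by blast
    obtain y where y: "y \<in> elts w" "elts y = insert v (elts v)" using step[OF v(1)] by blast
    have "y \<noteq> v" using y v(5) by auto
    moreover have "y \<notin> elts v" using y v(5,6) by blast
    ultimately show ?case using v y by (intro bexI[of _ y]) auto
  qed
  then have "\<exists>B \<subseteq> elts w. finite B \<and> card B = k" for k by metis
  then have "infinite (elts w)" by (metis card_mono Suc_n_not_le_n)
  then show ?thesis using w(1) by blast
qed

end

section \<open>Arithmetic and membership on one domain\<close>

definition eventually_equal :: "nat set \<Rightarrow> nat set \<Rightarrow> bool" where
  "eventually_equal X Y \<longleftrightarrow> (\<exists>k. \<forall>n \<ge> k. n \<in> X \<longleftrightarrow> n \<in> Y)"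

lemma sat_Imp: "sat A e (\<phi> \<^bold>\<longrightarrow> \<psi>) \<longleftrightarrow> (sat A e \<phi> \<longrightarrow> sat A e \<psi>)"
  by simp

text \<open>A model of set theory and a standard-number structure on the same domain, each definable in the
other. Every formula of one language has an equivalent in the other, so membership is expressed by
a formula \<open>member\<close> of arithmetic, and separation and collection hold for formulas of arithmetic.\<close>

locale arithmetic_on_sets = set_model A
  for A :: "(mem_sym, nat + nat set) struct" +
  fixes \<S> :: "nat set set"
  assumes Dom_A: "Dom A = UNIV <+> \<S>"
    and soa_to_mem: "wf_fm soa_arity \<phi> \<Longrightarrow> \<exists>\<phi>'. wf_fm mem_arity \<phi>' \<and>
      (\<forall>e. range e \<subseteq> UNIV <+> \<S> \<longrightarrow> sat A e \<phi>' = sat (omega_struct \<S>) e \<phi>)"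
    and mem_to_soa: "wf_fm mem_arity \<psi> \<Longrightarrow> \<exists>\<psi>'. wf_fm soa_arity \<psi>' \<and>
      (\<forall>e. range e \<subseteq> UNIV <+> \<S> \<longrightarrow> sat (omega_struct \<S>) e \<psi>' = sat A e \<psi>)"
begin

abbreviation arith :: "(soa_sym, nat + nat set) struct" where
  "arith \<equiv> omega_struct \<S>"

definition member :: "nat \<Rightarrow> nat \<Rightarrow> soa_sym fm" where
  "member x y = (SOME \<psi>. wf_fm soa_arity \<psi> \<and>
     (\<forall>e. range e \<subseteq> UNIV <+> \<S> \<longrightarrow> sat arith e \<psi> = (e x \<in> elts (e y))))"

lemma wf_member [simp]: "wf_fm soa_arity (member x y)"
  and sat_member: "range e \<subseteq> UNIV <+> \<S> \<Longrightarrow> sat arith e (member x y) = (e x \<in> elts (e y))"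
proof -
  have "wf_fm soa_arity (member x y) \<and>
    (\<forall>e. range e \<subseteq> UNIV <+> \<S> \<longrightarrow> sat arith e (member x y) = (e x \<in> elts (e y)))"
    unfolding member_def
    by (rule someI_ex) (use mem_to_soa[of "x \<^bold>\<in> y"] Dom_A in \<open>auto simp: elts_def\<close>)
  then show "wf_fm soa_arity (member x y)"
    "range e \<subseteq> UNIV <+> \<S> \<Longrightarrow> sat arith e (member x y) = (e x \<in> elts (e y))" by auto
qed

lemma soa_separation:
  assumes "wf_fm soa_arity \<phi>" "range e \<subseteq> UNIV <+> \<S>" "a \<in> UNIV <+> \<S>"
  shows "\<exists>b \<in> UNIV <+> \<S>. elts b = {x \<in> elts a. sat arith (e(i := x)) \<phi>}"
proof -
  obtain \<phi>' where \<phi>': "wf_fm mem_arity \<phi>'"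
    "\<forall>e. range e \<subseteq> UNIV <+> \<S> \<longrightarrow> sat A e \<phi>' = sat arith e \<phi>" using soa_to_mem assms(1) by blast
  have "range (e(i := x)) \<subseteq> UNIV <+> \<S>" if "x \<in> elts a" for x
    using that assms(2) elts_subset Dom_A by auto
  then have "{x \<in> elts a. sat A (e(i := x)) \<phi>'} = {x \<in> elts a. sat arith (e(i := x)) \<phi>}" using \<phi>' by blast
  then show ?thesis using separation[OF \<phi>'(1), of e a i] assms Dom_A by auto
qed

lemma soa_collection:
  assumes "wf_fm soa_arity \<phi>" "range e \<subseteq> UNIV <+> \<S>" "a \<in> UNIV <+> \<S>" "i \<noteq> j"
    and "\<forall>x \<in> elts a. \<exists>y \<in> UNIV <+> \<S>. sat arith (e(i := x, j := y)) \<phi>"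
  shows "\<exists>b \<in> UNIV <+> \<S>. \<forall>x \<in> elts a. \<exists>y \<in> elts b. sat arith (e(i := x, j := y)) \<phi>"
proof -
  obtain \<phi>' where \<phi>': "wf_fm mem_arity \<phi>'"
    "\<forall>e. range e \<subseteq> UNIV <+> \<S> \<longrightarrow> sat A e \<phi>' = sat arith e \<phi>" using soa_to_mem assms(1) by blast
  have "range (e(i := x, j := y)) \<subseteq> UNIV <+> \<S>" if "x \<in> elts a" "y \<in> UNIV <+> \<S>" for x y
    using that assms(2) elts_subset Dom_A by auto
  then have eq: "sat A (e(i := x, j := y)) \<phi>' = sat arith (e(i := x, j := y)) \<phi>"
    if "x \<in> elts a" "y \<in> UNIV <+> \<S>" for x y using \<phi>' that by blast
  have "\<exists>b \<in> Dom A. \<forall>x \<in> elts a. \<exists>y \<in> elts b. sat A (e(i := x, j := y)) \<phi>'"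
    by (rule collection[OF \<phi>'(1)]) (use assms Dom_A eq in auto)
  then show ?thesis using eq elts_subset Dom_A by (metis subsetD)
qed

text \<open>Otherwise, by collection, every definable function from a set to the numbers is bounded. Take an
infinite set \<open>w\<close>. For a fixed set of numbers \<open>X\<close> in \<open>w\<close>, there is then a bound below
which \<open>X\<close> differs from every other set of numbers in \<open>w\<close>, and these bounds have a common bound as
\<open>X\<close> varies over \<open>w\<close>. Sets of numbers in \<open>w\<close> are thus determined by their parts below a single number, and \<open>w\<close> has
finitely many of them; the numbers in \<open>w\<close> are finitely many by assumption.\<close>

lemma set_with_infinitely_many_numbers: "\<exists>b \<in> UNIV <+> \<S>. infinite {n. Inl n \<in> elts b}"
proof (rule ccontr)
  assume "\<not> ?thesis"
  then have fin: "finite {n. Inl n \<in> elts b}" if "b \<in> UNIV <+> \<S>" for b using that by blast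
  have bounded: "\<exists>M. \<forall>x \<in> elts a. \<exists>n \<le> M. sat arith (e(i := x, j := Inl n)) \<phi>"
    if prems: "wf_fm soa_arity \<phi>" "range e \<subseteq> UNIV <+> \<S>" "a \<in> UNIV <+> \<S>" "i \<noteq> j"
      and total: "\<forall>x \<in> elts a. \<exists>n. sat arith (e(i := x, j := Inl n)) \<phi>" for \<phi> e a i j
  proof -
    have "\<exists>b \<in> UNIV <+> \<S>. \<forall>x \<in> elts a. \<exists>y \<in> elts b. sat arith (e(i := x, j := y)) (Num j \<^bold>\<and> \<phi>)"
    proof (rule soa_collection)
      show "\<forall>x \<in> elts a. \<exists>y \<in> UNIV <+> \<S>. sat arith (e(i := x, j := y)) (Num j \<^bold>\<and> \<phi>)"
      proof
        fix x assume "x \<in> elts a"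
        then obtain n where "sat arith (e(i := x, j := Inl n)) \<phi>" using total by blast
        then show "\<exists>y \<in> UNIV <+> \<S>. sat arith (e(i := x, j := y)) (Num j \<^bold>\<and> \<phi>)"
          by (intro bexI[of _ "Inl n"]) auto
      qed
    qed (use prems in auto)
    then obtain b where b: "b \<in> UNIV <+> \<S>"
      "\<forall>x \<in> elts a. \<exists>y \<in> elts b. sat arith (e(i := x, j := y)) (Num j \<^bold>\<and> \<phi>)" by blast
    have "n \<le> Max {n. Inl n \<in> elts b}" if "Inl n \<in> elts b" for n
      using fin[OF b(1)] that by (intro Max_ge) auto
    then show ?thesis using b(2) by (intro exI[of _ "Max {n. Inl n \<in> elts b}"]) fastforce
  qed
  obtain w where w: "w \<in> UNIV <+> \<S>" "infinite (elts w)" using infinite_set_exists Dom_A by auto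
  have elts_S: "X \<in> \<S>" if "Inr X \<in> elts a" for X a using that elts_subset[of a] Dom_A by auto
  have bound1: "\<exists>M. \<forall>Y. Inr Y \<in> elts w \<longrightarrow> Y \<noteq> X \<longrightarrow> (\<exists>n \<le> M. n \<in> X \<longleftrightarrow> n \<notin> Y)" if X: "Inr X \<in> elts w" for X
  proof -
    let ?\<phi> = "Set 0 \<^bold>\<and> \<^bold>\<not> 0 \<^bold>= 2 \<^bold>\<longrightarrow> \<^bold>\<not> (Elem 9 0 \<^bold>\<longleftrightarrow> Elem 9 2)"
    let ?e = "(\<lambda>_. Inr X) :: nat \<Rightarrow> nat + nat set"
    have sat: "sat arith (?e(0 := y, 9 := Inl n)) ?\<phi> \<longleftrightarrow>
        (\<forall>Y. y = Inr Y \<longrightarrow> Y \<noteq> X \<longrightarrow> (n \<in> X \<longleftrightarrow> n \<notin> Y))" if "y \<in> elts w" for y n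
      using that elts_S X by (cases y) auto
    have "\<exists>M. \<forall>y \<in> elts w. \<exists>n \<le> M. sat arith (?e(0 := y, 9 := Inl n)) ?\<phi>"
    proof (rule bounded)
      show "\<forall>y \<in> elts w. \<exists>n. sat arith (?e(0 := y, 9 := Inl n)) ?\<phi>"
        by (intro ballI, subst sat) auto
      show "range ?e \<subseteq> UNIV <+> \<S>" using elts_S[OF X] by auto
    qed (use w in auto)
    then show ?thesis using sat by (metis (no_types, lifting))
  qed
  have bound2: "\<exists>M. \<forall>X Y. Inr X \<in> elts w \<longrightarrow> Inr Y \<in> elts w \<longrightarrow> Y \<noteq> X \<longrightarrow> (\<exists>n \<le> M. n \<in> X \<longleftrightarrow> n \<notin> Y)"
  proof -
    let ?\<phi> = "Set 0 \<^bold>\<longrightarrow> (\<^bold>\<forall>4. member 4 3 \<^bold>\<and> Set 4 \<^bold>\<and> \<^bold>\<not> 4 \<^bold>= 0 \<^bold>\<longrightarrow>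
      (\<^bold>\<exists>5. Num 5 \<^bold>\<and> \<^bold>\<not> Less 9 5 \<^bold>\<and> \<^bold>\<not> (Elem 5 0 \<^bold>\<longleftrightarrow> Elem 5 4)))"
    let ?e = "(\<lambda>_. w) :: nat \<Rightarrow> nat + nat set"
    have sat: "sat arith (?e(0 := x, 9 := Inl N)) ?\<phi> \<longleftrightarrow>
        (\<forall>X. x = Inr X \<longrightarrow> (\<forall>Y. Inr Y \<in> elts w \<longrightarrow> Y \<noteq> X \<longrightarrow> (\<exists>n \<le> N. n \<in> X \<longleftrightarrow> n \<notin> Y)))"
      if x: "x \<in> elts w" for x N
    proof (cases x)
      case (Inr X)
      have mem: "sat arith (?e(0 := x, 9 := Inl N, 4 := y)) (member 4 3) \<longleftrightarrow> y \<in> elts w" if "y \<in> UNIV <+> \<S>" for y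
      proof -
        have "range (?e(0 := x, 9 := Inl N, 4 := y)) \<subseteq> UNIV <+> \<S>"
          using that w x elts_subset Dom_A by auto
        then show ?thesis using sat_member[of _ 4 3] by simp
      qed
      have X: "X \<in> \<S>" using elts_S x Inr by blast
      have inner: "sat arith (?e(0 := x, 9 := Inl N, 4 := y)) (member 4 3 \<^bold>\<and> Set 4 \<^bold>\<and> \<^bold>\<not> 4 \<^bold>= 0 \<^bold>\<longrightarrow>
          (\<^bold>\<exists>5. Num 5 \<^bold>\<and> \<^bold>\<not> Less 9 5 \<^bold>\<and> \<^bold>\<not> (Elem 5 0 \<^bold>\<longleftrightarrow> Elem 5 4))) \<longleftrightarrow>
          (\<forall>Y. y = Inr Y \<longrightarrow> Inr Y \<in> elts w \<longrightarrow> Y \<noteq> X \<longrightarrow> (\<exists>n \<le> N. n \<in> X \<longleftrightarrow> n \<notin> Y))"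
        if y: "y \<in> UNIV <+> \<S>" for y
      proof (cases y)
        case (Inr Y)
        then have Y: "Y \<in> \<S>" using y by simp
        show ?thesis
          using mem[OF y] \<open>x = Inr X\<close> Inr X Y by (simp add: not_less) blast
      qed simp
      have "sat arith (?e(0 := x, 9 := Inl N)) (Set 0)" using Inr X by simp
      then have step: "sat arith (?e(0 := x, 9 := Inl N)) ?\<phi> \<longleftrightarrow> (\<forall>y \<in> Dom arith. \<forall>Y. y = Inr Y \<longrightarrow>
          Inr Y \<in> elts w \<longrightarrow> Y \<noteq> X \<longrightarrow> (\<exists>n \<le> N. n \<in> X \<longleftrightarrow> n \<notin> Y))"
        by (simp only: sat_Imp[of _ _ "Set 0"] sat.simps(5)[of _ _ 4] Dom_omega_struct simp_thms inner cong: ball_cong)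
      have "Inr Y \<in> Dom arith" if "Inr Y \<in> elts w" for Y using that elts_S by simp
      then show ?thesis unfolding step using Inr by blast
    qed auto
    have "\<exists>M. \<forall>x \<in> elts w. \<exists>N \<le> M. sat arith (?e(0 := x, 9 := Inl N)) ?\<phi>"
    proof (rule bounded)
      show "\<forall>x \<in> elts w. \<exists>N. sat arith (?e(0 := x, 9 := Inl N)) ?\<phi>"
      proof
        fix x assume x: "x \<in> elts w"
        show "\<exists>N. sat arith (?e(0 := x, 9 := Inl N)) ?\<phi>"
          unfolding sat[OF x] using bound1 x by (cases x) auto
      qed
    qed (use w in auto)
    then obtain M where M: "\<forall>x \<in> elts w. \<exists>N \<le> M. sat arith (?e(0 := x, 9 := Inl N)) ?\<phi>" ..
    have "\<exists>n \<le> M. n \<in> X \<longleftrightarrow> n \<notin> Y" if "Inr X \<in> elts w" "Inr Y \<in> elts w" "Y \<noteq> X" for X Y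
    proof -
      obtain N where "N \<le> M" "sat arith (?e(0 := Inr X, 9 := Inl N)) ?\<phi>" using M \<open>Inr X \<in> elts w\<close> by blast
      then have "\<exists>n \<le> N. n \<in> X \<longleftrightarrow> n \<notin> Y" unfolding sat[OF \<open>Inr X \<in> elts w\<close>] using that by blast
      then show ?thesis using \<open>N \<le> M\<close> order_trans by blast
    qed
    then show ?thesis by blast
  qed
  then obtain M where M: "\<And>X Y. Inr X \<in> elts w \<Longrightarrow> Inr Y \<in> elts w \<Longrightarrow> Y \<noteq> X \<Longrightarrow> \<exists>n \<le> M. n \<in> X \<longleftrightarrow> n \<notin> Y"
    by blast
  have "inj_on (\<lambda>X. X \<inter> {..M}) {X. Inr X \<in> elts w}"
    by (rule inj_onI, rule ccontr) (use M in blast)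
  moreover have "finite ((\<lambda>X. X \<inter> {..M}) ` {X. Inr X \<in> elts w})"
    by (rule finite_subset[of _ "Pow {..M}"]) auto
  ultimately have "finite {X. Inr X \<in> elts w}" by (rule finite_imageD[rotated])
  moreover have "elts w \<subseteq> Inl ` {n. Inl n \<in> elts w} \<union> Inr ` {X. Inr X \<in> elts w}"
  proof
    fix x assume "x \<in> elts w"
    then show "x \<in> Inl ` {n. Inl n \<in> elts w} \<union> Inr ` {X. Inr X \<in> elts w}" by (cases x) auto
  qed
  ultimately have "finite (elts w)" using fin[OF w(1)] by (meson finite_UnI finite_imageI finite_subset)
  then show False using w(2) by blast
qed

text \<open>The reals agreeing with \<open>C\<close> from \<open>k\<close> on are finitely many and so form a set. By collection, a set \<open>d\<close>
contains all of these sets for unboundedly many \<open>k\<close>; the class is separated from its union.\<close>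

lemma eventually_equal_class_exists:
  assumes C: "C \<in> \<S>"
  shows "\<exists>a \<in> UNIV <+> \<S>. elts a = {Inr X | X. X \<in> \<S> \<and> eventually_equal X C}"
proof -
  obtain b where b: "b \<in> UNIV <+> \<S>" "infinite {n. Inl n \<in> elts b}"
    using set_with_infinitely_many_numbers by blast
  define cls where "cls k = {X \<in> \<S>. \<forall>n \<ge> k. n \<in> X \<longleftrightarrow> n \<in> C}" for k :: nat
  have "finite (cls k)" for k
  proof (rule finite_imageD)
    show "finite ((\<lambda>X. X \<inter> {..<k}) ` cls k)" by (rule finite_subset[of _ "Pow {..<k}"]) auto
    show "inj_on (\<lambda>X. X \<inter> {..<k}) (cls k)"
      by (rule inj_onI) (auto simp: cls_def set_eq_iff; metis linorder_not_less)
  qed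
  then have cls_exists: "\<exists>a \<in> UNIV <+> \<S>. elts a = Inr ` cls k" for k
    using finite_set_exists[of "Inr ` cls k"] Dom_A by (auto simp: cls_def)
  let ?\<phi> = "Num 0 \<^bold>\<longrightarrow> (\<^bold>\<forall>4. member 4 9 \<^bold>\<longleftrightarrow> Set 4 \<^bold>\<and> (\<^bold>\<forall>5. Num 5 \<^bold>\<and> \<^bold>\<not> Less 5 0 \<^bold>\<longrightarrow> (Elem 5 4 \<^bold>\<longleftrightarrow> Elem 5 2)))"
  let ?e = "(\<lambda>_. Inr C) :: nat \<Rightarrow> nat + nat set"
  have sat: "sat arith (?e(0 := x, 9 := a)) ?\<phi> \<longleftrightarrow> (\<forall>k. x = Inl k \<longrightarrow> elts a = Inr ` cls k)"
    if x: "x \<in> UNIV <+> \<S>" "a \<in> UNIV <+> \<S>" for x a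
  proof -
    have mem: "sat arith (?e(0 := x, 9 := a, 4 := y)) (member 4 9) \<longleftrightarrow> y \<in> elts a" if "y \<in> UNIV <+> \<S>" for y
    proof -
      have "range (?e(0 := x, 9 := a, 4 := y)) \<subseteq> UNIV <+> \<S>" using that x C by auto
      then show ?thesis using sat_member[of _ 4 9] by simp
    qed
    have "elts a = Inr ` cls k \<longleftrightarrow> (\<forall>y \<in> UNIV <+> \<S>. y \<in> elts a \<longleftrightarrow> y \<in> Inr ` cls k)" for k
      using elts_subset[of a] Dom_A by (auto simp: cls_def)
    note elts_eq = this
    show ?thesis
    proof (cases x)
      case (Inl k)
      have inner: "sat arith (?e(0 := x, 9 := a, 4 := y)) (member 4 9 \<^bold>\<longleftrightarrow>
          Set 4 \<^bold>\<and> (\<^bold>\<forall>5. Num 5 \<^bold>\<and> \<^bold>\<not> Less 5 0 \<^bold>\<longrightarrow> (Elem 5 4 \<^bold>\<longleftrightarrow> Elem 5 2))) \<longleftrightarrow>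
          (y \<in> elts a \<longleftrightarrow> y \<in> Inr ` cls k)" if y: "y \<in> UNIV <+> \<S>" for y
        using mem[OF y] Inl C y by (cases y) (simp_all add: not_less cls_def image_iff, blast+)
      show ?thesis unfolding elts_eq using Inl inner by simp
    qed auto
  qed
  have "\<exists>d \<in> UNIV <+> \<S>. \<forall>x \<in> elts b. \<exists>a \<in> elts d. sat arith (?e(0 := x, 9 := a)) ?\<phi>"
  proof (rule soa_collection)
    show "\<forall>x \<in> elts b. \<exists>a \<in> UNIV <+> \<S>. sat arith (?e(0 := x, 9 := a)) ?\<phi>"
    proof
      fix x assume "x \<in> elts b"
      then have x: "x \<in> UNIV <+> \<S>" using elts_subset Dom_A by auto
      show "\<exists>a \<in> UNIV <+> \<S>. sat arith (?e(0 := x, 9 := a)) ?\<phi>"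
      proof (cases x)
        case (Inl k)
        then show ?thesis using cls_exists[of k] sat[OF x] by auto
      next
        case (Inr X)
        then show ?thesis using sat[OF x] x by auto
      qed
    qed
  qed (use C b in auto)
  then obtain d where d: "d \<in> UNIV <+> \<S>" "\<forall>x \<in> elts b. \<exists>a \<in> elts d. sat arith (?e(0 := x, 9 := a)) ?\<phi>" by blast
  have d_cls: "\<exists>a \<in> elts d. elts a = Inr ` cls k" if k_in: "Inl k \<in> elts b" for k
  proof -
    have k: "Inl k \<in> UNIV <+> \<S>" by simp
    obtain a where a: "a \<in> elts d" "sat arith (?e(0 := Inl k, 9 := a)) ?\<phi>"
      using bspec[OF d(2) k_in] by (rule bexE)
    have aU: "a \<in> UNIV <+> \<S>" using a(1) elts_subset Dom_A by auto
    have "elts a = Inr ` cls k"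
      using sat[OF k aU, THEN iffD1, OF a(2)] by blast
    then show ?thesis using a(1) by blast
  qed
  obtain u where u: "u \<in> UNIV <+> \<S>" "elts u = \<Union> (elts ` elts d)" using union[of d] d(1) Dom_A by auto
  \<comment> \<open>The union may collect stray elements from other elements of \<open>d\<close>, which separation removes.\<close>
  let ?\<psi> = "Set 2 \<^bold>\<and> (\<^bold>\<exists>5. Num 5 \<^bold>\<and> (\<^bold>\<forall>6. Num 6 \<^bold>\<and> \<^bold>\<not> Less 6 5 \<^bold>\<longrightarrow> (Elem 6 2 \<^bold>\<longleftrightarrow> Elem 6 0)))"
  obtain a where a: "a \<in> UNIV <+> \<S>" "elts a = {x \<in> elts u. sat arith (?e(2 := x)) ?\<psi>}"
    using soa_separation[of ?\<psi> ?e u 2] u(1) C by auto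
  have "x \<in> elts a \<longleftrightarrow> x \<in> {Inr X | X. X \<in> \<S> \<and> eventually_equal X C}" for x
  proof -
    have "sat arith (?e(2 := x)) ?\<psi> \<longleftrightarrow> (\<exists>X \<in> \<S>. x = Inr X \<and> eventually_equal X C)"
    proof (cases "\<exists>X \<in> \<S>. x = Inr X")
      case True
      then obtain X where "X \<in> \<S>" "x = Inr X" by blast
      then show ?thesis using C by (auto simp: eventually_equal_def not_less)
    qed auto
    moreover have "Inr X \<in> elts u" if "X \<in> \<S>" "eventually_equal X C" for X
    proof -
      obtain k where k: "\<forall>n \<ge> k. n \<in> X \<longleftrightarrow> n \<in> C" using \<open>eventually_equal X C\<close> by (auto simp: eventually_equal_def)
      obtain l where l: "Inl l \<in> elts b" "l \<ge> k"
        using b(2) infinite_nat_iff_unbounded_le[of "{n. Inl n \<in> elts b}"] by auto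
      then have "X \<in> cls l" using k that by (auto simp: cls_def)
      moreover obtain a' where "a' \<in> elts d" "elts a' = Inr ` cls l" using d_cls[OF l(1)] by (rule bexE)
      ultimately show ?thesis unfolding u(2) by (intro UN_I[of a']) simp_all
    qed
    ultimately show ?thesis unfolding a(2) by auto
  qed
  then show ?thesis using a(1) by blast
qed

end

context arithmetic_on_sets
begin

definition eventual_class :: "nat set \<Rightarrow> (nat + nat set) set" where
  "eventual_class C = {Inr X | X. X \<in> \<S> \<and> eventually_equal X C}"

text \<open>The definition, without parameters, of the element that represents the class of \<open>C\<close>.\<close>

lemma sat_eventual_class:
  assumes C: "C \<in> \<S>" and y: "y \<in> UNIV <+> \<S>"
  shows "sat arith ((\<lambda>_. Inl k)(0 := Inr C, 9 := y)) (\<^bold>\<forall>4. member 4 9 \<^bold>\<longleftrightarrow> Set 4 \<^bold>\<and>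
      (\<^bold>\<exists>5. Num 5 \<^bold>\<and> (\<^bold>\<forall>6. Num 6 \<^bold>\<and> \<^bold>\<not> Less 6 5 \<^bold>\<longrightarrow> (Elem 6 4 \<^bold>\<longleftrightarrow> Elem 6 0))))
    \<longleftrightarrow> elts y = eventual_class C"
proof -
  let ?e = "((\<lambda>_. Inl k)(0 := Inr C, 9 := y)) :: nat \<Rightarrow> nat + nat set"
  let ?\<psi> = "member 4 9 \<^bold>\<longleftrightarrow> Set 4 \<^bold>\<and>
      (\<^bold>\<exists>5. Num 5 \<^bold>\<and> (\<^bold>\<forall>6. Num 6 \<^bold>\<and> \<^bold>\<not> Less 6 5 \<^bold>\<longrightarrow> (Elem 6 4 \<^bold>\<longleftrightarrow> Elem 6 0)))"
  have inner: "sat arith (?e(4 := x)) ?\<psi> \<longleftrightarrow> (x \<in> elts y \<longleftrightarrow> x \<in> eventual_class C)"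
    if x: "x \<in> Dom arith" for x
  proof -
    have "range (?e(4 := x)) \<subseteq> UNIV <+> \<S>" using x y C by auto
    then have mem: "sat arith (?e(4 := x)) (member 4 9) \<longleftrightarrow> x \<in> elts y"
      using sat_member[of _ 4 9] by simp
    show ?thesis
    proof (cases x)
      case (Inl l)
      then show ?thesis using mem by (simp add: eventual_class_def)
    next
      case (Inr X)
      then have X: "X \<in> \<S>" using x by simp
      have "sat arith (?e(4 := Inr X)) (Set 4 \<^bold>\<and>
          (\<^bold>\<exists>5. Num 5 \<^bold>\<and> (\<^bold>\<forall>6. Num 6 \<^bold>\<and> \<^bold>\<not> Less 6 5 \<^bold>\<longrightarrow> (Elem 6 4 \<^bold>\<longleftrightarrow> Elem 6 0))))
          \<longleftrightarrow> Inr X \<in> eventual_class C"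
        using X C by (auto simp: eventual_class_def eventually_equal_def not_less)
      note eq = this[folded Inr]
      have Iff: "sat arith e (\<phi> \<^bold>\<longleftrightarrow> \<psi>) \<longleftrightarrow> (sat arith e \<phi> \<longleftrightarrow> sat arith e \<psi>)" for e \<phi> \<psi> by auto
      show ?thesis unfolding Iff mem eq ..
    qed
  qed
  have "elts y = eventual_class C \<longleftrightarrow> (\<forall>x \<in> Dom arith. x \<in> elts y \<longleftrightarrow> x \<in> eventual_class C)"
    using elts_subset[of y] Dom_A by (auto simp: eventual_class_def)
  then show ?thesis
    by (simp only: sat.simps(5)[of _ _ 4] inner cong: ball_cong)
qed

text \<open>Let \<open>a\<close> and \<open>b\<close> be the elements representing the classes of the complement of \<open>c\<close> and of \<open>c\<close>. Any
property of \<open>a\<close> with a number as parameter is a property of the complement and so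
transfers to some finite variant of \<open>c\<close>, that is, to \<open>b\<close>. As elements of the domain are numbers
or sets of numbers, such properties tell distinct elements apart.\<close>

lemma not_homogeneous:
  fixes c :: "nat \<Rightarrow> bool"
  assumes compl: "{n. \<not> c n} \<in> \<S>" and variants: "\<And>m. {n. c n \<noteq> (n < m)} \<in> \<S>"
    and homogeneous: "\<And>(d :: nat \<Rightarrow> nat) x \<phi>. sat arith ((\<lambda>i. Inl (d i))(x := Inr {n. \<not> c n})) \<phi> \<Longrightarrow>
      \<exists>m. sat arith ((\<lambda>i. Inl (d i))(x := Inr {n. c n \<noteq> (n < m)})) \<phi>"
  shows False
proof -
  define V where "V m = {n. c n \<noteq> (n < m)}" for m
  have V: "V m \<in> \<S>" for m unfolding V_def by (rule variants)
  obtain a where a: "a \<in> UNIV <+> \<S>" "elts a = eventual_class {n. \<not> c n}"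
    using eventually_equal_class_exists[OF compl] by (auto simp: eventual_class_def)
  obtain b where b: "b \<in> UNIV <+> \<S>" "elts b = eventual_class (V 0)"
    using eventually_equal_class_exists[OF V[of 0]] by (auto simp: eventual_class_def)
  have same: "eventually_equal X (V m) \<longleftrightarrow> eventually_equal X (V 0)" for X m
  proof
    assume "eventually_equal X (V m)"
    then obtain k where k: "\<forall>n \<ge> k. n \<in> X \<longleftrightarrow> n \<in> V m" by (auto simp: eventually_equal_def)
    then have "\<forall>n \<ge> max k m. n \<in> X \<longleftrightarrow> n \<in> V 0" by (auto simp: V_def)
    then show "eventually_equal X (V 0)" unfolding eventually_equal_def ..
  next
    assume "eventually_equal X (V 0)"
    then obtain k where k: "\<forall>n \<ge> k. n \<in> X \<longleftrightarrow> n \<in> V 0" by (auto simp: eventually_equal_def)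
    then have "\<forall>n \<ge> max k m. n \<in> X \<longleftrightarrow> n \<in> V m" by (auto simp: V_def)
    then show "eventually_equal X (V m)" unfolding eventually_equal_def ..
  qed
  have b': "y = b" if "y \<in> UNIV <+> \<S>" "elts y = eventual_class (V m)" for y m
  proof -
    have "eventual_class (V m) = eventual_class (V 0)" using same[of _ m] by (simp add: eventual_class_def)
    then show ?thesis using elts_inject[of y b] that b Dom_A by simp
  qed
  have "Inr (V 0) \<in> elts b" using V b(2) by (auto simp: eventual_class_def eventually_equal_def)
  moreover have "\<not> eventually_equal (V 0) {n. \<not> c n}" by (auto simp: V_def eventually_equal_def)
  then have "Inr (V 0) \<notin> elts a" using a(2) by (auto simp: eventual_class_def)
  ultimately have "a \<noteq> b" by auto
  have transfer: "\<exists>m. sat arith ((\<lambda>_. Inl k)(0 := Inr (V m), 9 := b)) \<theta>"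
    if \<theta>: "sat arith ((\<lambda>_. Inl k)(0 := Inr {n. \<not> c n}, 9 := a)) \<theta>" for k \<theta>
  proof -
    let ?\<psi> = "\<^bold>\<forall>4. member 4 9 \<^bold>\<longleftrightarrow> Set 4 \<^bold>\<and>
      (\<^bold>\<exists>5. Num 5 \<^bold>\<and> (\<^bold>\<forall>6. Num 6 \<^bold>\<and> \<^bold>\<not> Less 6 5 \<^bold>\<longrightarrow> (Elem 6 4 \<^bold>\<longleftrightarrow> Elem 6 0)))"
    have FEx: "sat arith e (\<^bold>\<exists>9. ?\<psi> \<^bold>\<and> \<theta>) \<longleftrightarrow>
        (\<exists>y \<in> UNIV <+> \<S>. sat arith (e(9 := y)) ?\<psi> \<and> sat arith (e(9 := y)) \<theta>)" for e
      unfolding sat.simps(3,4) sat.simps(5)[of _ _ 9] Dom_omega_struct by blast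
    have "sat arith ((\<lambda>_. Inl k)(0 := Inr {n. \<not> c n})) (\<^bold>\<exists>9. ?\<psi> \<^bold>\<and> \<theta>)"
      unfolding FEx using a \<theta> sat_eventual_class[OF compl a(1)] by blast
    then obtain m where "sat arith ((\<lambda>_. Inl k)(0 := Inr (V m))) (\<^bold>\<exists>9. ?\<psi> \<^bold>\<and> \<theta>)"
      using homogeneous[of "\<lambda>_. k" 0] unfolding V_def by blast
    then obtain y where y: "y \<in> UNIV <+> \<S>" "sat arith ((\<lambda>_. Inl k)(0 := Inr (V m), 9 := y)) ?\<psi>"
      "sat arith ((\<lambda>_. Inl k)(0 := Inr (V m), 9 := y)) \<theta>" unfolding FEx by blast
    have "y = b" using b'[OF y(1)] sat_eventual_class[OF V y(1)] y(2) by blast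
    then show ?thesis using y(3) by blast
  qed
  have "a = b"
  proof (cases a)
    case (Inl k)
    then show ?thesis using transfer[of k "9 \<^bold>= 3"] by simp
  next
    case (Inr Y)
    then have Y: "Y \<in> \<S>" using a(1) by simp
    obtain Z where Z: "b = Inr Z" "Z \<in> \<S>" using transfer[of 0 "Set 9"] Inr Y by auto
    have "k \<in> Y \<longleftrightarrow> k \<in> Z" for k
      using transfer[of k "Elem 3 9"] transfer[of k "\<^bold>\<not> Elem 3 9"] Inr Y Z by auto
    then show ?thesis using Inr Z by blast
  qed
  then show False using \<open>a \<noteq> b\<close> by blast
qed

end

section \<open>The two theories are not definitionally equivalent\<close>

theorem theorem10:
  assumes "infinite (UNIV :: 'a set)"
  shows "\<not> definitionally_equivalent TYPE('a) SOA ZFC_count"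
proof
  assume equiv: "definitionally_equivalent TYPE('a) SOA ZFC_count"
  obtain N c where N: "countable N" "cohen_extension N c" by (rule cohen_extension_exists)
  interpret cohen_extension N c by (rule N(2))
  obtain f :: "nat \<Rightarrow> 'a" where f: "inj f" using infinite_countable_subset[OF assms] by blast
  have "countable (Dom generic_model)" using N(1) by (simp add: Dom_generic_model)
  then have "inj_on (f \<circ> to_nat_on (Dom generic_model)) (Dom generic_model)"
    by (intro comp_inj_on inj_on_to_nat_on inj_on_subset[OF f]) auto
  then obtain t s where t: "direct_translation ZFC_count SOA t" and s: "direct_translation SOA ZFC_count s"
    and A: "induced ZFC_count t generic_model \<in> models ZFC_count"
    and recovered: "induced SOA s (induced ZFC_count t generic_model) = generic_model"
    using definitionally_equivalent_embedded[OF equiv generic_model_models_SOA] by blast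
  have Dom: "Dom (induced ZFC_count t generic_model) = UNIV <+> reals" by (simp add: induced_def)
  interpret arithmetic_on_sets "induced ZFC_count t generic_model" reals
  proof
    show "induced ZFC_count t generic_model \<in> models ZFC_count" by (rule A)
    show "Dom (induced ZFC_count t generic_model) = UNIV <+> reals" by (rule Dom)
    show "\<exists>\<phi>'. wf_fm mem_arity \<phi>' \<and> (\<forall>e. range e \<subseteq> UNIV <+> reals \<longrightarrow>
        sat (induced ZFC_count t generic_model) e \<phi>' = sat generic_model e \<phi>)" if "wf_fm soa_arity \<phi>" for \<phi>
    proof -
      have "wf_fm (arity SOA) \<phi>" using that by (simp add: SOA_def)
      obtain \<phi>' where "wf_fm (arity ZFC_count) \<phi>'" "\<forall>(A :: (mem_sym, nat + nat set) struct) e.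
          range e \<subseteq> Dom A \<longrightarrow> sat A e \<phi>' = sat (induced SOA s A) e \<phi>"
        using translate_formula[OF s \<open>wf_fm (arity SOA) \<phi>\<close>, where 'a = "nat + nat set"] by blast
      then show ?thesis using Dom recovered by (intro exI[of _ \<phi>']) (auto simp: ZFC_count_def)
    qed
    show "\<exists>\<psi>'. wf_fm soa_arity \<psi>' \<and> (\<forall>e. range e \<subseteq> UNIV <+> reals \<longrightarrow>
        sat generic_model e \<psi>' = sat (induced ZFC_count t generic_model) e \<psi>)" if "wf_fm mem_arity \<psi>" for \<psi>
    proof -
      have "wf_fm (arity ZFC_count) \<psi>" using that by (simp add: ZFC_count_def)
      obtain \<psi>' where "wf_fm (arity SOA) \<psi>'" "\<forall>(A :: (soa_sym, nat + nat set) struct) e.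
          range e \<subseteq> Dom A \<longrightarrow> sat A e \<psi>' = sat (induced ZFC_count t A) e \<psi>"
        using translate_formula[OF t \<open>wf_fm (arity ZFC_count) \<psi>\<close>, where 'a = "nat + nat set"] by blast
      then show ?thesis by (intro exI[of _ \<psi>']) (auto simp: SOA_def)
    qed
  qed
  show False
  proof (rule not_homogeneous)
    show "{n. \<not> c n} \<in> reals" using flipped_real[of UNIV] by simp
    show "{n. c n \<noteq> (n < m)} \<in> reals" for m using flipped_real[of "{..<m}" m] by simp
  qed (rule homogeneity)
qed

end
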